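(* Fix $c>0$. The smooth solitary wave profiles $\phi$ of the Novikov equation belonging to the family $\mathcal{W}_c$ described in the context can be smoothly parameterized by their asymptotic end state $k=\lim_{x\to\pm\infty}\phi(x)$, where $k$ ranges over $$0<k<\frac{\sqrt{c}}{2}.$$ That is: every $\phi\in\mathcal{W}_c$ has end state $k\in(0,\sqrt{c}/2)$; for each $k\in(0,\sqrt{c}/2)$ there is exactly one $\phi=\phi(\cdot;k)\in\mathcal{W}_c$ with end state $k$; and $\phi(x;k)$ depends smoothly on $k$.
   Context: The Novikov equation is $u_t-u_{xxt}=u^2u_{xxx}-4u^2u_x+3uu_xu_{xx}$. For fixed $c>0$ and each $0<a<\frac{3\sqrt{3}c^2}{16}$ there is a unique nonconstant smooth $\phi$ on $\mathbb{R}$ having a common finite limit at $\pm\infty$ and satisfying $\phi-\phi''=a(c-\phi^2)^{-3/2}$, $\phi^2<c$ and $\phi-\phi''>0$ on $\mathbb{R}$, and $\phi'(0)=0$; then $u(x,t)=\phi(x-ct)$ solves the Novikov equation. $\mathcal{W}_c$ denotes the set of all these profiles as $a$ ranges over $\left(0,\frac{3\sqrt3c^2}{16}\right)$. *)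

theory Defs
  imports "HOL-Analysis.Analysis"
begin

text \<open>
  \<open>Ck_on n f S\<close> is \<open>n\<close>-fold continuous differentiability on an open set \<open>S\<close>, by recursion on the
  order through all directional derivatives; continuity of the top-order derivatives makes this
  the usual class $C^n$ for a finite-dimensional domain.
\<close>
primrec Ck_on ::
  "nat \<Rightarrow> ('a::euclidean_space \<Rightarrow> 'b::real_normed_vector) \<Rightarrow> 'a set \<Rightarrow> bool" where
  "Ck_on 0 f S \<longleftrightarrow> continuous_on S f"
| "Ck_on (Suc n) f S \<longleftrightarrow>
     (\<forall>x\<in>S. f differentiable (at x)) \<and>
     (\<forall>v. Ck_on n (\<lambda>x. frechet_derivative f (at x) v) S)"

definition smooth_on :: "('a::euclidean_space \<Rightarrow> 'b::real_normed_vector) \<Rightarrow> 'a set \<Rightarrow> bool" where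
  "smooth_on f S \<longleftrightarrow> open S \<and> (\<forall>n. Ck_on n f S)"

definition has_end_state :: "(real \<Rightarrow> real) \<Rightarrow> real \<Rightarrow> bool" where
  "has_end_state \<phi> k \<longleftrightarrow> (\<phi> \<longlongrightarrow> k) at_top \<and> (\<phi> \<longlongrightarrow> k) at_bot"

definition novikov_profile :: "real \<Rightarrow> real \<Rightarrow> (real \<Rightarrow> real) \<Rightarrow> bool" where
  "novikov_profile c a \<phi> \<longleftrightarrow>
     smooth_on \<phi> UNIV \<and>
     \<not> \<phi> constant_on UNIV \<and>
     (\<exists>l. has_end_state \<phi> l) \<and>
     (\<forall>x. \<phi> x - deriv (deriv \<phi>) x = a * (c - (\<phi> x)\<^sup>2) powr (- 3 / 2)) \<and>
     (\<forall>x. (\<phi> x)\<^sup>2 < c) \<and>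
     (\<forall>x. \<phi> x - deriv (deriv \<phi>) x > 0) \<and>
     deriv \<phi> 0 = 0"

definition novikov_W :: "real \<Rightarrow> (real \<Rightarrow> real) set" where
  "novikov_W c = {\<phi>. \<exists>a. 0 < a \<and> a < 3 * sqrt 3 * c\<^sup>2 / 16 \<and> novikov_profile c a \<phi>}"

text \<open>The profile \<open>\<phi>(\<cdot>; k)\<close>; meaningful only where existence and uniqueness hold.\<close>
definition wave_of_end_state :: "real \<Rightarrow> real \<Rightarrow> real \<Rightarrow> real" where
  "wave_of_end_state c k = (THE \<phi>. \<phi> \<in> novikov_W c \<and> has_end_state \<phi> k)"

end

theory Submission
  imports Defs
begin

text \<open>
  For a profile with end state \<open>k\<close> put \<open>\<tau> = \<phi> / sqrt (c - \<phi>\<^sup>2)\<close> and \<open>t = k / sqrt (c - k\<^sup>2)\<close>.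
  The first integral becomes
  \<open>\<phi>'\<^sup>2 = c * (\<tau> - t)\<^sup>2 * (1 - t\<^sup>2 - 2 * t * \<tau>) / ((1 + \<tau>\<^sup>2) * (1 + t\<^sup>2)\<^sup>2)\<close>.
  If \<open>3 * t\<^sup>2 > 1\<close> it is negative near but off the equilibrium, so only constants converge to it;
  hence \<open>k < sqrt c / 2\<close>.  If \<open>3 * t\<^sup>2 < 1\<close>, it fixes \<open>\<phi> 0\<close> as the nontrivial zero, and
  uniqueness for the initial value problem shows that \<open>k\<close> determines \<open>\<phi>\<close>.  For existence, the
  signed root \<open>w\<close> of \<open>1 - t\<^sup>2 - 2 * t * \<tau>\<close> regularises the turning point, and the equation for
  \<open>w\<close> integrates in closed form: \<open>x\<close> is an elementary function of \<open>(w, t)\<close> with positive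
  derivative in \<open>w\<close>.  Smooth dependence on \<open>k\<close> is then the implicit function theorem.
\<close>

section \<open>Calculus of smooth functions\<close>

lemma Ck_on_cong:
  assumes "open S" "\<And>x. x \<in> S \<Longrightarrow> f x = g x" "Ck_on n f S"
  shows "Ck_on n g S"
  using assms(2,3)
proof (induction n arbitrary: f g)
  case 0
  then show ?case by (simp cong: continuous_on_cong)
next
  case (Suc n)
  have d: "(g has_derivative frechet_derivative f (at x)) (at x)" if "x \<in> S" for x
  proof -
    have "(f has_derivative frechet_derivative f (at x)) (at x)"
      using Suc.prems that by (simp add: frechet_derivative_works)
    then show ?thesis
      using has_derivative_transform_within_open \<open>open S\<close> that Suc.prems(1) by blast
  qed
  have "Ck_on n (\<lambda>x. frechet_derivative g (at x) v) S" for v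
  proof (rule Suc.IH)
    show "Ck_on n (\<lambda>x. frechet_derivative f (at x) v) S" using Suc.prems by simp
    show "frechet_derivative f (at x) v = frechet_derivative g (at x) v" if "x \<in> S" for x
      using frechet_derivative_at[OF d[OF that]] by simp
  qed
  then show ?case using d by (auto simp: differentiable_def)
qed

text \<open>Derivatives are unique, so any explicit derivative may stand in for the choice-defined
  \<open>frechet_derivative\<close>; every later smoothness proof enters through this rule or its
  real-variable form.\<close>

lemma Ck_on_SucI:
  assumes "open S" "\<And>x. x \<in> S \<Longrightarrow> (f has_derivative f' x) (at x)"
    and "\<And>v. Ck_on n (\<lambda>x. f' x v) S"
  shows "Ck_on (Suc n) f S"
proof -
  have "Ck_on n (\<lambda>x. frechet_derivative f (at x) v) S" for v
    by (rule Ck_on_cong[OF assms(1) _ assms(3)[of v]])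
       (simp add: frechet_derivative_at[OF assms(2)])
  then show ?thesis using assms(2) by (auto simp: differentiable_def)
qed

text \<open>The base case is that differentiability implies continuity. Dropping an order supplies
  the undifferentiated factors that the product and chain rules leave behind.\<close>

lemma Ck_on_Suc_imp_Ck_on: "Ck_on (Suc n) f S \<Longrightarrow> Ck_on n f S"
proof (induction n arbitrary: f)
  case 0
  then show ?case
    by (auto intro!: continuous_at_imp_continuous_on differentiable_imp_continuous_within)
next
  case (Suc n)
  have "\<forall>x\<in>S. f differentiable at x"
    and "\<forall>v. Ck_on (Suc n) (\<lambda>x. frechet_derivative f (at x) v) S"
    using Suc.prems Ck_on.simps(2)[of "Suc n" f S] by blast+
  then show ?case using Suc.IH Ck_on.simps(2)[of n f S] by blast
qed

lemma Ck_on_subset: "Ck_on n f S \<Longrightarrow> T \<subseteq> S \<Longrightarrow> Ck_on n f T"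
  by (induction n arbitrary: f) (auto intro: continuous_on_subset)

lemma Ck_on_const: "open S \<Longrightarrow> Ck_on n (\<lambda>x. a) S"
  by (induction n arbitrary: a)
     (auto intro!: Ck_on_SucI[where f' = "\<lambda>_ _. 0"] simp del: Ck_on.simps(2))

lemma Ck_on_Suc_has_derivative:
  "Ck_on (Suc n) f S \<Longrightarrow> x \<in> S \<Longrightarrow> (f has_derivative frechet_derivative f (at x)) (at x)"
  by (simp add: frechet_derivative_works)

lemma Ck_on_add:
  assumes "open S" "Ck_on n f S" "Ck_on n g S"
  shows "Ck_on n (\<lambda>x. f x + g x) S"
  using assms(2,3)
proof (induction n arbitrary: f g)
  case 0
  then show ?case by (simp add: continuous_on_add)
next
  case (Suc n)
  show ?case
    by (rule Ck_on_SucI[OF \<open>open S\<close> has_derivative_add])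
       (use Suc in \<open>auto intro: Ck_on_Suc_has_derivative simp: frechet_derivative_works\<close>)
qed

lemma Ck_on_sum:
  assumes "open S" "\<And>i. i \<in> I \<Longrightarrow> Ck_on n (f i) S"
  shows "Ck_on n (\<lambda>x. \<Sum>i\<in>I. f i x) S"
  using assms(2)
  by (induction I rule: infinite_finite_induct) (auto intro: Ck_on_const Ck_on_add assms(1))

lemma Ck_on_bounded_linear:
  assumes "bounded_linear L" "open S" "Ck_on n f S"
  shows "Ck_on n (\<lambda>x. L (f x)) S"
  using assms(3)
proof (induction n arbitrary: f)
  case 0
  then show ?case
    using assms(1) by (simp add: bounded_linear.continuous_on)
next
  case (Suc n)
  show ?case
    by (rule Ck_on_SucI[OF \<open>open S\<close> bounded_linear.has_derivative[OF assms(1)]])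
       (use Suc in \<open>auto simp: frechet_derivative_works\<close>)
qed

lemma Ck_on_bounded_bilinear:
  assumes "bounded_bilinear B" "open S" "Ck_on n f S" "Ck_on n g S"
  shows "Ck_on n (\<lambda>x. B (f x) (g x)) S"
  using assms(3,4)
proof (induction n arbitrary: f g)
  case 0
  then show ?case
    using assms(1) by (simp add: bounded_bilinear.continuous_on)
next
  case (Suc n)
  have low: "Ck_on n f S" "Ck_on n g S"
    using Suc.prems Ck_on_Suc_imp_Ck_on by blast+
  show ?case
  proof (rule Ck_on_SucI[OF \<open>open S\<close> bounded_bilinear.FDERIV[OF assms(1)]])
    fix v
    show "Ck_on n (\<lambda>x. B (f x) (frechet_derivative g (at x) v)
        + B (frechet_derivative f (at x) v) (g x)) S"
      using Suc low by (intro Ck_on_add \<open>open S\<close> Suc.IH) auto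
  qed (use Suc.prems in \<open>auto simp: frechet_derivative_works\<close>)
qed

text \<open>In the chain rule the direction fed to the derivative of \<open>f\<close> itself varies
  with \<open>x\<close>. Expanding it in \<open>Basis\<close> leaves a finite sum of products whose
  factors involve only fixed directions, so the induction hypothesis applies to each.\<close>

lemma Ck_on_compose:
  assumes "open S" "open T" "g ` S \<subseteq> T" "Ck_on n f T" "Ck_on n g S"
  shows "Ck_on n (\<lambda>x. f (g x)) S"
  using assms(4,5)
proof (induction n arbitrary: f)
  case 0
  then show ?case using assms(3) continuous_on_compose2 by fastforce
next
  case (Suc n)
  have f: "(f has_derivative frechet_derivative f (at y)) (at y)" if "y \<in> T" for y
    using Suc.prems that Ck_on_Suc_has_derivative by blast
  have g: "(g has_derivative frechet_derivative g (at x)) (at x)" if "x \<in> S" for x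
    using Suc.prems that Ck_on_Suc_has_derivative by blast
  have g_low: "Ck_on n g S" using Suc.prems Ck_on_Suc_imp_Ck_on by blast
  show ?case
  proof (rule Ck_on_SucI[OF \<open>open S\<close>])
    fix x assume x: "x \<in> S"
    show "((\<lambda>x. f (g x)) has_derivative
        (\<lambda>v. \<Sum>b\<in>Basis. (frechet_derivative g (at x) v \<bullet> b) *\<^sub>R
            frechet_derivative f (at (g x)) b)) (at x)"
    proof -
      have gx: "g x \<in> T" using x assms(3) by blast
      have lin: "linear (frechet_derivative f (at (g x)))"
        using f[OF gx] has_derivative_linear by blast
      have rep: "frechet_derivative f (at (g x)) u =
          (\<Sum>b\<in>Basis. (u \<bullet> b) *\<^sub>R frechet_derivative f (at (g x)) b)" for u
        using linear_sum[OF lin, of "\<lambda>b. (u \<bullet> b) *\<^sub>R b" Basis]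
        by (simp add: euclidean_representation linear_scale[OF lin])
      show ?thesis
        by (rule has_derivative_eq_rhs[OF has_derivative_compose[OF g[OF x] f[OF gx]]])
           (rule ext, rule rep)
    qed
  next
    fix v
    have "Ck_on n (\<lambda>x. frechet_derivative g (at x) v \<bullet> b) S" for b
      using Suc.prems
      by (intro Ck_on_bounded_linear[OF bounded_linear_inner_left \<open>open S\<close>]) simp
    moreover have "Ck_on n (\<lambda>x. frechet_derivative f (at (g x)) b) S" for b
      using Suc.prems(1) g_low by (intro Suc.IH) auto
    ultimately show "Ck_on n (\<lambda>x. \<Sum>b\<in>Basis. (frechet_derivative g (at x) v \<bullet> b) *\<^sub>R
        frechet_derivative f (at (g x)) b) S"
      by (intro Ck_on_sum Ck_on_bounded_bilinear[OF bounded_bilinear_scaleR] \<open>open S\<close>)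
  qed
qed

lemma Ck_on_Pair:
  assumes "open S" "Ck_on n f S" "Ck_on n g S"
  shows "Ck_on n (\<lambda>x. (f x, g x)) S"
  using assms(2,3)
proof (induction n arbitrary: f g)
  case 0
  then show ?case by (simp add: continuous_on_Pair)
next
  case (Suc n)
  show ?case
    by (rule Ck_on_SucI[OF \<open>open S\<close> has_derivative_Pair])
       (use Suc in \<open>auto simp: frechet_derivative_works\<close>)
qed

lemma Ck_on_linear:
  assumes "bounded_linear L" "open S"
  shows "Ck_on n L S"
proof (cases n)
  case 0
  then show ?thesis using assms by (simp add: linear_continuous_on)
next
  case (Suc m)
  show ?thesis
    unfolding Suc using assms
    by (intro Ck_on_SucI[where f' = "\<lambda>_. L"] Ck_on_const bounded_linear_imp_has_derivative)
qed

lemma Ck_on_Suc_realI: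
  assumes "open S" "\<And>x::real. x \<in> S \<Longrightarrow> (f has_real_derivative f' x) (at x)" "Ck_on n f' S"
  shows "Ck_on (Suc n) f S"
  using assms
  by (intro Ck_on_SucI[where f' = "\<lambda>x v. f' x * v"] Ck_on_const
      Ck_on_bounded_bilinear[OF bounded_bilinear_mult])
     (auto simp: has_field_derivative_def)

lemma Ck_on_Suc_realD:
  fixes f :: "real \<Rightarrow> real"
  assumes "open S" "Ck_on (Suc n) f S"
  shows "\<And>x. x \<in> S \<Longrightarrow> (f has_real_derivative deriv f x) (at x)" and "Ck_on n (deriv f) S"
proof -
  show d: "(f has_real_derivative deriv f x) (at x)" if "x \<in> S" for x
    using assms that by (auto simp: DERIV_deriv_iff_real_differentiable)
  show "Ck_on n (deriv f) S"
  proof (rule Ck_on_cong[OF \<open>open S\<close>])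
    show "Ck_on n (\<lambda>x. frechet_derivative f (at x) 1) S" using assms by simp
    show "frechet_derivative f (at x) 1 = deriv f x" if "x \<in> S" for x
      using frechet_derivative_at[OF d[OF that, unfolded has_field_derivative_def]]
      by (metis mult.right_neutral)
  qed
qed

section \<open>Closure properties of smooth functions and the elementary functions\<close>

lemma smooth_on_compose:
  "smooth_on g S \<Longrightarrow> smooth_on f T \<Longrightarrow> g ` S \<subseteq> T \<Longrightarrow> smooth_on (\<lambda>x. f (g x)) S"
  unfolding smooth_on_def using Ck_on_compose by blast

lemma smooth_on_cong:
  "smooth_on f S \<Longrightarrow> (\<And>x. x \<in> S \<Longrightarrow> f x = g x) \<Longrightarrow> smooth_on g S"
  unfolding smooth_on_def using Ck_on_cong by blast

lemma smooth_on_const: "open S \<Longrightarrow> smooth_on (\<lambda>x. a) S"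
  by (simp add: smooth_on_def Ck_on_const)

lemma smooth_on_fst: "open S \<Longrightarrow> smooth_on fst S"
  and smooth_on_snd: "open S \<Longrightarrow> smooth_on snd S"
  by (simp_all add: smooth_on_def Ck_on_linear bounded_linear_fst bounded_linear_snd)

lemma smooth_on_id: "open S \<Longrightarrow> smooth_on (\<lambda>x. x) S"
  by (simp add: smooth_on_def Ck_on_linear bounded_linear_ident)

lemma smooth_on_Pair: "smooth_on f S \<Longrightarrow> smooth_on g S \<Longrightarrow> smooth_on (\<lambda>x. (f x, g x)) S"
  by (simp add: smooth_on_def Ck_on_Pair)

lemma smooth_on_add: "smooth_on f S \<Longrightarrow> smooth_on g S \<Longrightarrow> smooth_on (\<lambda>x. f x + g x) S"
  by (simp add: smooth_on_def Ck_on_add)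

lemma smooth_on_mult:
  fixes f g :: "'a::euclidean_space \<Rightarrow> real"
  shows "smooth_on f S \<Longrightarrow> smooth_on g S \<Longrightarrow> smooth_on (\<lambda>x. f x * g x) S"
  by (simp add: smooth_on_def Ck_on_bounded_bilinear[OF bounded_bilinear_mult])

lemma smooth_on_diff:
  fixes f g :: "'a::euclidean_space \<Rightarrow> real"
  assumes "smooth_on f S" "smooth_on g S"
  shows "smooth_on (\<lambda>x. f x - g x) S"
proof -
  have "open S" using assms by (simp add: smooth_on_def)
  then have "smooth_on (\<lambda>x. f x + (-1) * g x) S"
    by (intro smooth_on_add smooth_on_mult smooth_on_const assms)
  then show ?thesis by simp
qed

lemma smooth_on_power:
  fixes f :: "'a::euclidean_space \<Rightarrow> real"
  assumes "smooth_on f S"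
  shows "smooth_on (\<lambda>x. f x ^ n) S"
proof (induction n)
  case 0
  then show ?case using assms by (simp add: smooth_on_def Ck_on_const)
next
  case (Suc n)
  then show ?case by (simp add: smooth_on_mult assms)
qed

text \<open>The derivative is a product of copies of the function itself, up to sign, so the
  induction on the order closes.\<close>

lemma smooth_on_inverse_real: "smooth_on inverse (- {0::real})"
proof -
  have "Ck_on n inverse (- {0::real})" for n
  proof (induction n)
    case 0
    then show ?case by (auto intro!: continuous_intros)
  next
    case (Suc n)
    show ?case
    proof (rule Ck_on_Suc_realI)
      show "(inverse has_real_derivative -1 * (inverse x * inverse x)) (at x)"
        if "x \<in> - {0}" for x :: real
        using that by (auto intro!: derivative_eq_intros simp: power2_eq_square)
      show "Ck_on n (\<lambda>x::real. -1 * (inverse x * inverse x)) (- {0})"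
        by (intro Ck_on_bounded_bilinear[OF bounded_bilinear_mult] Ck_on_const Suc.IH) auto
    qed auto
  qed
  then show ?thesis by (simp add: smooth_on_def open_Compl)
qed

lemma smooth_on_ln_real: "smooth_on ln {0::real<..}"
proof -
  have "Ck_on n ln {0::real<..}" for n
  proof (cases n)
    case 0
    then show ?thesis by (auto intro!: continuous_intros)
  next
    case (Suc m)
    have "Ck_on m inverse {0::real<..}"
      using smooth_on_inverse_real by (auto simp: smooth_on_def intro: Ck_on_subset)
    then show ?thesis
      unfolding Suc
      by (intro Ck_on_Suc_realI) (auto intro!: derivative_eq_intros simp: field_simps)
  qed
  then show ?thesis by (simp add: smooth_on_def)
qed

text \<open>The derivative is half of \<open>inverse\<close> composed with \<open>sqrt\<close>, so
  order \<open>n\<close> of \<open>sqrt\<close> gives order \<open>n\<close> of its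
  derivative.\<close>

lemma smooth_on_sqrt_real: "smooth_on sqrt {0<..}"
proof -
  have "Ck_on n sqrt {0<..}" for n
  proof (induction n)
    case 0
    then show ?case by (auto intro!: continuous_intros)
  next
    case (Suc n)
    show ?case
    proof (rule Ck_on_Suc_realI)
      show "(sqrt has_real_derivative (inverse (sqrt x) * (1 / 2))) (at x)"
        if "x \<in> {0<..}" for x
        using that by (auto intro!: derivative_eq_intros)
      have "Ck_on n (\<lambda>x. inverse (sqrt x)) {0<..}"
        by (rule Ck_on_compose[OF _ _ _ _ Suc.IH, where T = "- {0}"])
           (use smooth_on_inverse_real in \<open>auto simp: smooth_on_def\<close>)
      then show "Ck_on n (\<lambda>x. inverse (sqrt x) * (1 / 2)) {0<..}"
        by (intro Ck_on_bounded_bilinear[OF bounded_bilinear_mult] Ck_on_const) auto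
    qed auto
  qed
  then show ?thesis by (simp add: smooth_on_def)
qed

lemma smooth_on_divide:
  fixes f g :: "'a::euclidean_space \<Rightarrow> real"
  assumes "smooth_on f S" "smooth_on g S" "\<And>x. x \<in> S \<Longrightarrow> g x \<noteq> 0"
  shows "smooth_on (\<lambda>x. f x / g x) S"
  unfolding divide_inverse
  by (intro smooth_on_mult assms smooth_on_compose[OF assms(2) smooth_on_inverse_real])
     (use assms(3) in auto)

lemma smooth_on_ln:
  fixes f :: "'a::euclidean_space \<Rightarrow> real"
  assumes "smooth_on f S" "\<And>x. x \<in> S \<Longrightarrow> 0 < f x"
  shows "smooth_on (\<lambda>x. ln (f x)) S"
  by (rule smooth_on_compose[OF assms(1) smooth_on_ln_real]) (use assms(2) in auto)

lemma smooth_on_sqrt: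
  fixes f :: "'a::euclidean_space \<Rightarrow> real"
  assumes "smooth_on f S" "\<And>x. x \<in> S \<Longrightarrow> 0 < f x"
  shows "smooth_on (\<lambda>x. sqrt (f x)) S"
  by (rule smooth_on_compose[OF assms(1) smooth_on_sqrt_real]) (use assms(2) in auto)

lemmas smooth_on_intros = smooth_on_const smooth_on_fst smooth_on_snd smooth_on_id smooth_on_Pair
  smooth_on_add smooth_on_mult smooth_on_diff smooth_on_power smooth_on_divide smooth_on_ln
  smooth_on_sqrt

text \<open>
  The derivative of \<open>W\<close> is a smooth function of \<open>(W (x, t), t)\<close>, so each order of
  differentiability of \<open>W\<close> yields the next one.
\<close>
lemma smooth_on_implicit:
  fixes H W :: "real \<times> real \<Rightarrow> real"
  assumes H: "smooth_on H D" and U: "open U"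
    and nz: "\<And>p. p \<in> D \<Longrightarrow> frechet_derivative H (at p) (1, 0) \<noteq> 0"
    and W: "\<And>x t. (x, t) \<in> U \<Longrightarrow> (W (x, t), t) \<in> D \<and> H (W (x, t), t) = x"
    and inv: "\<And>w t. (w, t) \<in> D \<Longrightarrow> W (H (w, t), t) = w"
  shows "smooth_on W U"
proof -
  define Hw where "Hw p = frechet_derivative H (at p) (1, 0)" for p
  define Ht where "Ht p = frechet_derivative H (at p) (0, 1)" for p
  have D: "open D" using H by (simp add: smooth_on_def)
  have Ck: "Ck_on n Hw D" "Ck_on n Ht D" for n
    using H unfolding smooth_on_def Hw_def Ht_def by (auto dest: spec[of _ "Suc n"])
  have smooth: "smooth_on Hw D" "smooth_on Ht D"
    using Ck D by (auto simp: smooth_on_def)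
  \<comment> \<open>Implicit differentiation of \<open>H (W (x, t), t) = x\<close> gives W_x = 1 /
    H_w and W_t = - H_t / H_w, taken at \<open>(W (x, t), t)\<close>.\<close>
  define A where "A = (\<lambda>p. 1 / Hw p)"
  define B where "B = (\<lambda>p. (0 - Ht p) / Hw p)"
  have AB: "smooth_on A D" "smooth_on B D"
    unfolding A_def B_def
    by (intro smooth_on_intros smooth D; use nz in \<open>simp add: Hw_def\<close>)+
  have dH: "(H has_derivative (\<lambda>v. Hw p * fst v + Ht p * snd v)) (at p)" if "p \<in> D" for p
  proof -
    have d: "(H has_derivative frechet_derivative H (at p)) (at p)"
      using H that Ck_on_Suc_has_derivative[of 0 H D] by (auto simp: smooth_on_def simp del: Ck_on.simps)
    then have lin: "linear (frechet_derivative H (at p))" by (rule has_derivative_linear)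
    have "frechet_derivative H (at p) v = Hw p * fst v + Ht p * snd v" for v
    proof -
      have "v = fst v *\<^sub>R (1, 0) + snd v *\<^sub>R (0, 1)" by (cases v) simp
      then have "frechet_derivative H (at p) v =
          frechet_derivative H (at p) (fst v *\<^sub>R (1, 0) + snd v *\<^sub>R (0, 1))"
        by simp
      also have "\<dots> = fst v *\<^sub>R Hw p + snd v *\<^sub>R Ht p"
        unfolding linear_add[OF lin] linear_scale[OF lin] Hw_def Ht_def ..
      finally show ?thesis by (simp add: mult.commute)
    qed
    then have "frechet_derivative H (at p) = (\<lambda>v. Hw p * fst v + Ht p * snd v)" by blast
    then show ?thesis using d by simp
  qed
  \<comment> \<open>Carrying \<open>t\<close> along as a second component turns the implicit
    function into an inverse one, so the inverse function theorem provides the derivative of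
    \<open>G\<close>.\<close>
  define F where "F = (\<lambda>p. (H p, snd p))"
  define G where "G = (\<lambda>q. (W q, snd q))"
  have dG: "(G has_derivative (\<lambda>v. (A (G q) * fst v + B (G q) * snd v, snd v))) (at q)"
    if "q \<in> U" for q
  proof -
    have Gq: "G q \<in> D" and FG: "F (G q) = q"
      using W[of "fst q" "snd q"] that by (auto simp: F_def G_def)
    have cont: "continuous_on D F"
      using H unfolding F_def smooth_on_def
      by (auto intro!: continuous_intros dest: spec[of _ 0])
    have "(G has_derivative (\<lambda>v. (A (G q) * fst v + B (G q) * snd v, snd v))) (at (F (G q)))"
    proof (rule has_derivative_inverse_strong[OF D Gq cont])
      show "G (F p) = p" if "p \<in> D" for p
        using inv[of "fst p" "snd p"] that by (simp add: F_def G_def prod_eq_iff)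
      show "(F has_derivative (\<lambda>v. (Hw (G q) * fst v + Ht (G q) * snd v, snd v))) (at (G q))"
        unfolding F_def by (intro has_derivative_Pair dH Gq has_derivative_snd has_derivative_ident)
      show "(\<lambda>v. (Hw (G q) * fst v + Ht (G q) * snd v, snd v)) \<circ>
          (\<lambda>v. (A (G q) * fst v + B (G q) * snd v, snd v)) = id"
        using nz[OF Gq] by (auto simp: fun_eq_iff A_def B_def Hw_def field_simps)
    qed
    then show ?thesis by (simp only: FG)
  qed
  have "Ck_on n G U" for n
  proof (induction n)
    case 0
    then show ?case
      using dG by (auto intro!: continuous_at_imp_continuous_on has_derivative_continuous)
  next
    case (Suc n)
    have sub: "G ` U \<subseteq> D" using W by (auto simp: G_def)
    have "Ck_on n (\<lambda>q. A (G q)) U" "Ck_on n (\<lambda>q. B (G q)) U"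
      using AB by (auto intro!: Ck_on_compose[OF U D sub] Suc.IH simp: smooth_on_def)
    then show ?case
      by (intro Ck_on_SucI[OF U dG] Ck_on_Pair Ck_on_add Ck_on_const
          Ck_on_bounded_bilinear[OF bounded_bilinear_mult] U)
  qed
  then have "smooth_on G U" using U by (simp add: smooth_on_def)
  then have "smooth_on (\<lambda>q. fst (G q)) U"
    by (rule smooth_on_compose[OF _ smooth_on_fst[OF open_UNIV]]) simp
  then show ?thesis by (simp add: G_def)
qed

section \<open>Second-order equations and limits at infinity\<close>

text \<open>Gronwall's argument in the phase plane: the squared distance \<open>E\<close> of the two
  trajectories satisfies E' \<le> (1 + L) E for a Lipschitz constant \<open>L\<close> of
  \<open>f\<close>, so E exp(-(1 + L) y) cannot grow from its initial value 0.\<close>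

lemma second_order_ode_unique_right:
  fixes u v u' v' f f' :: "real \<Rightarrow> real"
  assumes u: "\<And>x. (u has_real_derivative u' x) (at x)" "\<And>x. (u' has_real_derivative f (u x)) (at x)"
    and v: "\<And>x. (v has_real_derivative v' x) (at x)" "\<And>x. (v' has_real_derivative f (v x)) (at x)"
    and f: "\<And>s. s \<in> {\<alpha><..<\<beta>} \<Longrightarrow> (f has_real_derivative f' s) (at s)"
      "continuous_on {\<alpha><..<\<beta>} f'"
    and range: "\<And>x. u x \<in> {\<alpha><..<\<beta>}" "\<And>x. v x \<in> {\<alpha><..<\<beta>}"
    and init: "u p = v p" "u' p = v' p" and "p \<le> x"
  shows "u x = v x"
proof -
  \<comment> \<open>\<open>f\<close> need not be Lipschitz up to the ends of the interval, but it is
    on \<open>{m..M}\<close>, the compact hull of both trajectories over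
    \<open>{p..x}\<close>.\<close>
  let ?K = "u ` {p..x} \<union> v ` {p..x}"
  have cont: "continuous_on {p..x} u" "continuous_on {p..x} v"
    using u(1) v(1) by (auto intro!: continuous_at_imp_continuous_on DERIV_isCont)
  then have K: "compact ?K" "?K \<noteq> {}"
    using \<open>p \<le> x\<close> by (auto intro!: compact_Un compact_continuous_image)
  obtain m where m: "m \<in> ?K" "\<And>y. y \<in> ?K \<Longrightarrow> m \<le> y"
    using compact_attains_inf[OF K] by blast
  obtain M where M: "M \<in> ?K" "\<And>y. y \<in> ?K \<Longrightarrow> y \<le> M"
    using compact_attains_sup[OF K] by blast
  have in_range: "y \<in> {\<alpha><..<\<beta>}" if "y \<in> ?K" for y
    using that range by blast
  have sub: "{m..M} \<subseteq> {\<alpha><..<\<beta>}"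
    using in_range[OF m(1)] in_range[OF M(1)] by auto
  have "bounded (f' ` {m..M})"
    by (intro compact_imp_bounded compact_continuous_image continuous_on_subset[OF f(2) sub]) simp
  then obtain L where "0 < L" and "\<forall>y\<in>f' ` {m..M}. norm y \<le> L"
    unfolding bounded_pos by blast
  then have L: "\<bar>f' s\<bar> \<le> L" if "s \<in> {m..M}" for s
    using that by auto
  have lip: "\<bar>f r - f s\<bar> \<le> L * \<bar>r - s\<bar>" if "r \<in> {m..M}" "s \<in> {m..M}" for r s
  proof -
    have "norm (f r - f s) \<le> L * norm (r - s)"
    proof (rule field_differentiable_bound[OF convex_real_interval(5)[of m M]])
      show "(f has_field_derivative f' z) (at z within {m..M})" if "z \<in> {m..M}" for z
        using f(1) sub that by (blast intro: has_field_derivative_at_within)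
    qed (use L that in auto)
    then show ?thesis by simp
  qed
  define E where "E y = (u y - v y)\<^sup>2 + (u' y - v' y)\<^sup>2" for y
  define g where "g y = E y * exp (- ((1 + L) * y))" for y
  have "g x \<le> g p"
  proof (rule DERIV_nonpos_imp_nonincreasing[OF \<open>p \<le> x\<close>])
    fix y assume y: "p \<le> y" "y \<le> x"
    define d where "d = u y - v y"
    define e where "e = u' y - v' y"
    define h where "h = f (u y) - f (v y)"
    have "\<bar>h\<bar> \<le> L * \<bar>d\<bar>"
      unfolding h_def d_def using y m(2) M(2) by (intro lip) auto
    then have "\<bar>e\<bar> * \<bar>h\<bar> \<le> \<bar>e\<bar> * (L * \<bar>d\<bar>)" by (intro mult_left_mono) auto
    moreover have "2 * (\<bar>e\<bar> * \<bar>d\<bar>) \<le> d\<^sup>2 + e\<^sup>2"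
      using sum_squares_bound[of "\<bar>e\<bar>" "\<bar>d\<bar>"] by simp
    moreover have "L * (2 * (\<bar>e\<bar> * \<bar>d\<bar>)) \<le> L * (d\<^sup>2 + e\<^sup>2)"
      using calculation(2) \<open>0 < L\<close> by (intro mult_left_mono) auto
    moreover have "d * e \<le> \<bar>e\<bar> * \<bar>d\<bar>" "e * h \<le> \<bar>e\<bar> * \<bar>h\<bar>"
      by (metis abs_ge_self abs_mult mult.commute)+
    ultimately have "2 * d * e + 2 * e * h \<le> (1 + L) * (d\<^sup>2 + e\<^sup>2)"
      by (simp add: algebra_simps)
    then have "(2 * d * e + 2 * e * h - (1 + L) * E y) * exp (- ((1 + L) * y)) \<le> 0"
      by (intro mult_nonpos_nonneg) (auto simp: E_def d_def e_def)
    moreover have "(g has_real_derivative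
        (2 * d * e + 2 * e * h - (1 + L) * E y) * exp (- ((1 + L) * y))) (at y)"
      unfolding g_def E_def d_def e_def h_def
      by (rule derivative_eq_intros u v refl | simp)+ (simp add: algebra_simps)
    ultimately show "\<exists>z. (g has_real_derivative z) (at y) \<and> z \<le> 0" by blast
  qed
  then have "E x \<le> 0"
    using init by (simp add: g_def E_def mult_le_0_iff)
  then have "(u x - v x)\<^sup>2 \<le> 0"
    unfolding E_def using zero_le_power2[of "u' x - v' x"] by linarith
  then show ?thesis by simp
qed

lemma second_order_ode_unique:
  fixes u v u' v' f f' :: "real \<Rightarrow> real"
  assumes u: "\<And>x. (u has_real_derivative u' x) (at x)" "\<And>x. (u' has_real_derivative f (u x)) (at x)"
    and v: "\<And>x. (v has_real_derivative v' x) (at x)" "\<And>x. (v' has_real_derivative f (v x)) (at x)"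
    and f: "\<And>s. s \<in> {\<alpha><..<\<beta>} \<Longrightarrow> (f has_real_derivative f' s) (at s)"
      "continuous_on {\<alpha><..<\<beta>} f'"
    and range: "\<And>x. u x \<in> {\<alpha><..<\<beta>}" "\<And>x. v x \<in> {\<alpha><..<\<beta>}"
    and init: "u p = v p" "u' p = v' p"
  shows "u = v"
proof
  fix x
  \<comment> \<open>The equation contains no first derivative, so reflecting \<open>x\<close>
    preserves it and the left half-line reduces to the right one.\<close>
  have refl1: "((\<lambda>x. g (- x)) has_real_derivative - g' (- x)) (at x)"
    if "\<And>x. (g has_real_derivative g' x) (at x)" for g g' :: "real \<Rightarrow> real" and x
    using that[of "- x"] by (simp only: DERIV_mirror)
  have refl2: "((\<lambda>x. - g (- x)) has_real_derivative g' (- x)) (at x)"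
    if "\<And>x. (g has_real_derivative g' x) (at x)" for g g' :: "real \<Rightarrow> real" and x
    using DERIV_minus[OF refl1[OF that]] by simp
  show "u x = v x"
  proof (cases "p \<le> x")
    case True
    show ?thesis
      by (rule second_order_ode_unique_right[OF u v f range init True])
  next
    case False
    have "(\<lambda>x. u (- x)) (- x) = (\<lambda>x. v (- x)) (- x)"
      by (rule second_order_ode_unique_right[where u' = "\<lambda>x. - u' (- x)" and v' = "\<lambda>x. - v' (- x)"
            and p = "- p", OF refl1[OF u(1)] refl2[OF u(2)] refl1[OF v(1)] refl2[OF v(2)] f])
         (use range init False in auto)
    then show ?thesis by simp
  qed
qed

section \<open>Derivatives of convergent functions\<close>

lemma tendsto_shift_at_top:
  fixes f :: "real \<Rightarrow> real"
  assumes "(f \<longlongrightarrow> l) at_top"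
  shows "((\<lambda>x. f (x + s)) \<longlongrightarrow> l) at_top"
  using filterlim_compose[OF assms filterlim_tendsto_add_at_top[OF tendsto_const filterlim_ident]]
  by (subst add.commute)

text \<open>Two applications of the mean value theorem write the second difference with step 1 as a
  value of \<open>f''\<close> further right. The second difference tends to 0 because
  \<open>f\<close> converges.\<close>

lemma second_derivative_not_eventually_neg:
  fixes f f' f'' :: "real \<Rightarrow> real"
  assumes f: "\<And>x. (f has_real_derivative f' x) (at x)"
    and f': "\<And>x. (f' has_real_derivative f'' x) (at x)"
    and lim: "(f \<longlongrightarrow> l) at_top" and "0 < e"
  shows "\<not> (\<forall>\<^sub>F x in at_top. f'' x \<le> - e)"
proof
  assume "\<forall>\<^sub>F x in at_top. f'' x \<le> - e"
  then obtain N where N: "\<And>x. N \<le> x \<Longrightarrow> f'' x \<le> - e"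
    by (auto simp: eventually_at_top_linorder)
  have le: "f (x + 2) - 2 * f (x + 1) + f x \<le> - e" if "N \<le> x" for x
  proof -
    have d: "((\<lambda>y. f (y + 1) - f y) has_real_derivative f' (y + 1) - f' y) (at y)" for y
      by (intro DERIV_diff f DERIV_shift[THEN iffD1])
    obtain y where y: "x < y"
      and 1: "(f (x + 1 + 1) - f (x + 1)) - (f (x + 1) - f x) = (x + 1 - x) * (f' (y + 1) - f' y)"
      using MVT2[of x "x + 1" "\<lambda>y. f (y + 1) - f y", OF _ d] by auto
    obtain z where z: "y < z" and 2: "f' (y + 1) - f' y = (y + 1 - y) * f'' z"
      using MVT2[of y "y + 1" f', OF _ f'] by auto
    have "f'' z \<le> - e" using N y z that by simp
    then show ?thesis using 1 2 by (simp add: add.assoc)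
  qed
  have "((\<lambda>x. f (x + 2) - 2 * f (x + 1) + f x) \<longlongrightarrow> l - 2 * l + l) at_top"
    by (intro tendsto_intros tendsto_shift_at_top lim)
  then have "l - 2 * l + l \<le> - e"
    by (rule tendsto_upperbound) (use le in \<open>auto simp: eventually_at_top_linorder\<close>)
  then show False using \<open>0 < e\<close> by simp
qed

lemma second_derivative_limit_eq_0:
  fixes f f' f'' :: "real \<Rightarrow> real"
  assumes f: "\<And>x. (f has_real_derivative f' x) (at x)"
    and f': "\<And>x. (f' has_real_derivative f'' x) (at x)"
    and lim: "(f \<longlongrightarrow> l) at_top" and L: "(f'' \<longlongrightarrow> L) at_top"
  shows "L = 0"
proof (rule ccontr)
  assume "L \<noteq> 0"
  then consider "L < 0" | "0 < L" by linarith
  then show False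
  proof cases
    case 1
    then have "\<forall>\<^sub>F x in at_top. f'' x < L / 2" by (intro order_tendstoD(2)[OF L]) simp
    then have "\<forall>\<^sub>F x in at_top. f'' x \<le> - (- L / 2)" by eventually_elim simp
    then show False
      using second_derivative_not_eventually_neg[OF f f' lim, of "- L / 2"] 1 by auto
  next
    case 2
    then have "\<forall>\<^sub>F x in at_top. L / 2 < f'' x" by (intro order_tendstoD(1)[OF L]) simp
    then have "\<forall>\<^sub>F x in at_top. - f'' x \<le> - (L / 2)" by eventually_elim simp
    then show False
      using second_derivative_not_eventually_neg[OF DERIV_minus[OF f] DERIV_minus[OF f']
          tendsto_minus[OF lim], of "L / 2"] 2 by auto
  qed
qed

text \<open>The mean value theorem on unit intervals gives points \<open>y x\<close> tending to
  infinity along which \<open>f'\<close> tends to 0. The limit \<open>C\<close>, assumed to exist,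
  can be read off there.\<close>

lemma derivative_square_limit_eq_0:
  fixes f f' :: "real \<Rightarrow> real"
  assumes f: "\<And>x. (f has_real_derivative f' x) (at x)"
    and lim: "(f \<longlongrightarrow> l) at_top" and C: "((\<lambda>x. (f' x)\<^sup>2) \<longlongrightarrow> C) at_top"
  shows "C = 0"
proof -
  have "\<exists>y>x. f (x + 1) - f x = f' y" for x
    using MVT2[of x "x + 1" f, OF _ f] by auto
  then obtain y where y: "\<And>x. x < y x" "\<And>x. f (x + 1) - f x = f' (y x)"
    by metis
  have "filterlim y at_top at_top"
    by (rule filterlim_at_top_mono[OF filterlim_ident]) (use y(1) in \<open>simp add: less_imp_le\<close>)
  then have 1: "((\<lambda>x. (f' (y x))\<^sup>2) \<longlongrightarrow> C) at_top"
    by (rule filterlim_compose[OF C])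
  have "((\<lambda>x. f (x + 1)) \<longlongrightarrow> l) at_top"
    by (rule tendsto_shift_at_top[OF lim])
  then have "((\<lambda>x. (f (x + 1) - f x)\<^sup>2) \<longlongrightarrow> (l - l)\<^sup>2) at_top"
    by (intro tendsto_intros lim)
  then have "((\<lambda>x. (f' (y x))\<^sup>2) \<longlongrightarrow> 0) at_top"
    by (simp add: y(2))
  then show ?thesis
    using tendsto_unique[OF _ 1] by simp
qed

section \<open>End states and uniqueness\<close>

lemma powr_minus_three_halves: "0 < y \<Longrightarrow> y powr (- 3 / 2) = 1 / sqrt y ^ 3" for y :: real
proof -
  assume "0 < y"
  then have "sqrt y ^ 3 = (y powr (1 / 2)) powr real 3"
    by (simp add: powr_half_sqrt powr_realpow del: powr_powr)
  also have "\<dots> = y powr (3 / 2)" by (simp add: powr_powr)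
  finally show ?thesis by (simp add: powr_minus_divide)
qed

text \<open>
  With \<open>s = sqrt c * sin \<theta>\<close> this is \<open>tan \<theta>\<close>; in this variable the first integral of the
  profile equation becomes rational.
\<close>
definition slope :: "real \<Rightarrow> real \<Rightarrow> real" where
  "slope c s = s / sqrt (c - s\<^sup>2)"

text \<open>The inverse of \<open>slope c\<close>: sqrt c times the sine of the angle whose tangent
  is \<tau>. It is defined for every real \<tau> and stays strictly between - sqrt c and sqrt c when
  c > 0.\<close>

definition height :: "real \<Rightarrow> real \<Rightarrow> real" where
  "height c \<tau> = sqrt c * \<tau> / sqrt (1 + \<tau>\<^sup>2)"

lemma one_plus_slope_square: "s\<^sup>2 < c \<Longrightarrow> 1 + (slope c s)\<^sup>2 = c / (c - s\<^sup>2)"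
  by (simp add: slope_def power_divide field_simps)

lemma height_slope:
  assumes "s\<^sup>2 < c"
  shows "height c (slope c s) = s"
proof -
  have "0 < c" using assms zero_le_power2[of s] by linarith
  then show ?thesis
    using assms by (simp add: height_def one_plus_slope_square real_sqrt_divide) (simp add: slope_def)
qed

lemma height_square: "0 < c \<Longrightarrow> (height c \<tau>)\<^sup>2 = c * \<tau>\<^sup>2 / (1 + \<tau>\<^sup>2)"
  by (simp add: height_def power_divide power_mult_distrib add_nonneg_nonneg)

lemma height_square_less: "0 < c \<Longrightarrow> (height c \<tau>)\<^sup>2 < c"
  unfolding height_square by (simp add: field_simps add_pos_nonneg)

text \<open>Both conditions say that 4 s^2 < c; in the angle variable the threshold is
  \<pi>/6.\<close>

lemma slope_square_less_iff:
  assumes "0 < c" "0 < s" "s\<^sup>2 < c"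
  shows "3 * (slope c s)\<^sup>2 < 1 \<longleftrightarrow> s < sqrt c / 2"
proof -
  have "3 * (slope c s)\<^sup>2 < 1 \<longleftrightarrow> 4 * s\<^sup>2 < c"
    using assms by (auto simp: slope_def power_divide field_simps)
  also have "\<dots> \<longleftrightarrow> sqrt ((2 * s)\<^sup>2) < sqrt c"
    by (simp add: power_mult_distrib)
  also have "\<dots> \<longleftrightarrow> s < sqrt c / 2"
    using assms(2) by (simp only: real_sqrt_abs) auto
  finally show ?thesis .
qed

lemma slope_square_eq_third:
  assumes "0 < s" "s\<^sup>2 < c" "3 * (slope c s)\<^sup>2 = 1"
  shows "s = sqrt c / 2"
proof -
  have "c = (2 * s)\<^sup>2"
    using assms by (simp add: slope_def power_divide field_simps)
  then show ?thesis using assms(1) by (simp only: real_sqrt_abs)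
qed

text \<open>The right-hand side of the profile equation solved for \<phi>''. Writing the power -3/2
  through \<open>sqrt\<close> leaves only integer powers to differentiate.\<close>

definition restoring_force :: "real \<Rightarrow> real \<Rightarrow> real \<Rightarrow> real" where
  "restoring_force c a s = s - a / sqrt (c - s\<^sup>2) ^ 3"

lemma square_less_iff_interval: "s\<^sup>2 < c \<longleftrightarrow> s \<in> {- sqrt c<..<sqrt c}" for s c :: real
proof -
  have "s\<^sup>2 < c \<longleftrightarrow> \<bar>s\<bar> < sqrt c"
    using real_sqrt_less_iff[of "s\<^sup>2" c] by simp
  then show ?thesis by auto
qed

lemma DERIV_sqrt_diff_square:
  "s\<^sup>2 < c \<Longrightarrow> ((\<lambda>s. sqrt (c - s\<^sup>2)) has_real_derivative - s / sqrt (c - s\<^sup>2)) (at s)"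
  by (auto intro!: derivative_eq_intros simp: divide_simps)

lemma DERIV_restoring_force:
  assumes "s\<^sup>2 < c"
  shows "(restoring_force c a has_real_derivative 1 - 3 * a * s / sqrt (c - s\<^sup>2) ^ 5) (at s)"
proof -
  define q where "q = sqrt (c - s\<^sup>2)"
  have q: "0 < q" using assms by (simp add: q_def)
  have "(restoring_force c a has_real_derivative
      1 - (0 * q ^ 3 - a * (real 3 * (- s / q * q ^ (3 - Suc 0)))) / (q ^ 3 * q ^ 3)) (at s)"
    unfolding restoring_force_def[abs_def] q_def
    by (intro DERIV_diff DERIV_ident DERIV_divide DERIV_const DERIV_power
        DERIV_sqrt_diff_square assms) (use assms in auto)
  also have "1 - (0 * q ^ 3 - a * (real 3 * (- s / q * q ^ (3 - Suc 0)))) / (q ^ 3 * q ^ 3) =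
      1 - 3 * a * s / q ^ 5"
    using q by (simp add: field_simps eval_nat_numeral)
  finally show ?thesis by (simp add: q_def)
qed

lemma continuous_on_restoring_force_deriv:
  "continuous_on {- sqrt c<..<sqrt c} (\<lambda>s. 1 - 3 * a * s / sqrt (c - s\<^sup>2) ^ 5)"
proof (intro continuous_intros ballI)
  fix s assume "s \<in> {- sqrt c<..<sqrt c}"
  then have "s\<^sup>2 < c" by (simp only: square_less_iff_interval)
  then show "sqrt (c - s\<^sup>2) ^ 5 \<noteq> 0" by simp
qed

lemma novikov_profile_deriv:
  assumes "novikov_profile c a \<phi>"
  shows "(\<phi> has_real_derivative deriv \<phi> x) (at x)"
    and "(deriv \<phi> has_real_derivative restoring_force c a (\<phi> x)) (at x)"
    and "(\<phi> x)\<^sup>2 < c"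
proof -
  have C2: "Ck_on (Suc (Suc 0)) \<phi> UNIV"
    using assms unfolding novikov_profile_def smooth_on_def by blast
  show "(\<phi> has_real_derivative deriv \<phi> x) (at x)"
    using Ck_on_Suc_realD(1)[OF open_UNIV C2] by simp
  show sq: "(\<phi> x)\<^sup>2 < c" using assms by (simp add: novikov_profile_def)
  have "\<phi> x - deriv (deriv \<phi>) x = a * (c - (\<phi> x)\<^sup>2) powr (- 3 / 2)"
    using assms unfolding novikov_profile_def by blast
  then have "deriv (deriv \<phi>) x = restoring_force c a (\<phi> x)"
    unfolding restoring_force_def
    using sq by (subst (asm) powr_minus_three_halves) simp_all
  then show "(deriv \<phi> has_real_derivative restoring_force c a (\<phi> x)) (at x)"
    using Ck_on_Suc_realD(1)[OF open_UNIV Ck_on_Suc_realD(2)[OF open_UNIV C2], of x] by simp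
qed

lemma novikov_profile_unique:
  assumes "novikov_profile c a \<phi>"
    and "\<And>x. (\<psi> has_real_derivative \<psi>' x) (at x)"
    and "\<And>x. (\<psi>' has_real_derivative restoring_force c a (\<psi> x)) (at x)"
    and "\<And>x. (\<psi> x)\<^sup>2 < c" and "\<phi> p = \<psi> p" "deriv \<phi> p = \<psi>' p"
  shows "\<phi> = \<psi>"
  by (rule second_order_ode_unique[where f = "restoring_force c a" and \<alpha> = "- sqrt c" and \<beta> = "sqrt c",
        OF novikov_profile_deriv(1,2)[OF assms(1)] assms(2,3)
        DERIV_restoring_force continuous_on_restoring_force_deriv _ _ assms(5,6)])
     (use novikov_profile_deriv(3)[OF assms(1)] assms(4) in \<open>simp_all only: square_less_iff_interval\<close>)

text \<open>Otherwise the profile and the constant \<open>l\<close> share initial data at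
  \<open>p\<close>, hence coincide, against nonconstancy.\<close>

lemma novikov_profile_not_equilibrium:
  assumes "novikov_profile c a \<phi>" "restoring_force c a l = 0" "l\<^sup>2 < c" "deriv \<phi> p = 0"
  shows "\<phi> p \<noteq> l"
proof
  assume "\<phi> p = l"
  then have "\<phi> = (\<lambda>_. l)"
    using assms by (intro novikov_profile_unique[where \<psi>' = "\<lambda>_. 0" and p = p]) auto
  then have "\<phi> constant_on UNIV" by (auto simp: constant_on_def)
  then show False using assms(1) by (simp add: novikov_profile_def)
qed

text \<open>If l^2 were c, the singular term would drive \<phi>'' to minus infinity, which a
  convergent \<phi> does not allow. So the force is continuous at \<open>l\<close>, \<phi>''
  converges to its value there, and that value must be 0.\<close>

lemma novikov_end_state_equilibrium:
  assumes \<phi>: "novikov_profile c a \<phi>" and "0 < a" and lim: "(\<phi> \<longlongrightarrow> l) at_top"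
  shows "l\<^sup>2 < c" and "restoring_force c a l = 0"
proof -
  note d = novikov_profile_deriv[OF \<phi>]
  have lim2: "((\<lambda>x. sqrt (c - (\<phi> x)\<^sup>2)) \<longlongrightarrow> sqrt (c - l\<^sup>2)) at_top"
    by (intro tendsto_intros lim)
  have "l\<^sup>2 \<le> c"
    by (rule tendsto_upperbound[OF tendsto_power[OF lim]])
       (use d(3) in \<open>auto simp: less_imp_le eventually_at_top_linorder\<close>)
  moreover have "l\<^sup>2 \<noteq> c"
  proof
    assume "l\<^sup>2 = c"
    then have "((\<lambda>x. sqrt (c - (\<phi> x)\<^sup>2) ^ 3) \<longlongrightarrow> 0) at_top"
      using tendsto_power[OF lim2, of 3] by simp
    moreover have "\<forall>\<^sub>F x in at_top. 0 < sqrt (c - (\<phi> x)\<^sup>2) ^ 3"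
      using d(3) by simp
    ultimately have "filterlim (\<lambda>x. sqrt (c - (\<phi> x)\<^sup>2) ^ 3) (at_right 0) at_top"
      by (rule tendsto_imp_filterlim_at_right)
    then have "filterlim (\<lambda>x. inverse (sqrt (c - (\<phi> x)\<^sup>2) ^ 3)) at_top at_top"
      by (rule filterlim_compose[OF filterlim_inverse_at_top_right])
    \<comment> \<open>The bound is chosen so that, together with \<phi> < l + 1, the force drops to
      at most -1.\<close>
    then have "\<forall>\<^sub>F x in at_top. (l + 2) / a \<le> inverse (sqrt (c - (\<phi> x)\<^sup>2) ^ 3)"
      by (simp add: filterlim_at_top)
    moreover have "\<forall>\<^sub>F x in at_top. \<phi> x < l + 1"
      by (intro order_tendstoD(2)[OF lim]) simp
    ultimately have "\<forall>\<^sub>F x in at_top. restoring_force c a (\<phi> x) \<le> - 1"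
    proof eventually_elim
      case (elim x)
      have "l + 2 \<le> a * inverse (sqrt (c - (\<phi> x)\<^sup>2) ^ 3)"
        using elim(1) \<open>0 < a\<close> by (simp add: pos_divide_le_eq mult.commute)
      then show ?case using elim(2) by (simp add: restoring_force_def divide_inverse)
    qed
    then show False
      using second_derivative_not_eventually_neg[OF d(1,2) lim, of 1] by simp
  qed
  ultimately show sq: "l\<^sup>2 < c" by simp
  have "((\<lambda>x. restoring_force c a (\<phi> x)) \<longlongrightarrow> restoring_force c a l) at_top"
    unfolding restoring_force_def using sq by (intro tendsto_intros lim) auto
  then show "restoring_force c a l = 0"
    by (rule second_derivative_limit_eq_0[OF d(1,2) lim])
qed

lemma restoring_force_eq_0_iff:
  "l\<^sup>2 < c \<Longrightarrow> restoring_force c a l = 0 \<longleftrightarrow> a = l * sqrt (c - l\<^sup>2) ^ 3"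
  by (auto simp: restoring_force_def field_simps)

section \<open>The first integral and its consequences for the end state\<close>

lemma DERIV_slope:
  assumes "s\<^sup>2 < c"
  shows "(slope c has_real_derivative c / sqrt (c - s\<^sup>2) ^ 3) (at s)"
proof -
  define q where "q = sqrt (c - s\<^sup>2)"
  have q: "0 < q" "q\<^sup>2 = c - s\<^sup>2" using assms by (simp_all add: q_def)
  then have c: "c = q\<^sup>2 + s\<^sup>2" by simp
  from DERIV_divide[OF DERIV_ident DERIV_sqrt_diff_square[OF assms]]
  have "(slope c has_real_derivative (q - s * (- s / q)) / q\<^sup>2) (at s)"
    unfolding slope_def[abs_def] power2_eq_square[of q]
    using q(1) by (simp only: q_def[symmetric] mult_1_left)
  also have "(q - s * (- s / q)) / q\<^sup>2 = c / q ^ 3"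
    unfolding c using q(1) by (simp add: field_simps eval_nat_numeral)
  finally show ?thesis by (simp add: q_def)
qed

text \<open>
  The first integral \<open>\<phi>'\<^sup>2 - \<phi>\<^sup>2 + 2 * (a / c) * slope c \<phi>\<close>, evaluated at infinity.  The double
  root at \<open>\<tau> = t\<close> reflects that the end state is an equilibrium.
\<close>
lemma novikov_first_integral:
  fixes x :: real
  assumes \<phi>: "novikov_profile c a \<phi>" and "0 < a" "0 < c" and lim: "(\<phi> \<longlongrightarrow> l) at_top"
  defines "t \<equiv> slope c l" and "\<tau> \<equiv> slope c (\<phi> x)"
  shows "(deriv \<phi> x)\<^sup>2 =
    c * (\<tau> - t)\<^sup>2 * (1 - t\<^sup>2 - 2 * t * \<tau>) / ((1 + \<tau>\<^sup>2) * (1 + t\<^sup>2)\<^sup>2)"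
proof -
  note d = novikov_profile_deriv[OF \<phi>]
  note l = novikov_end_state_equilibrium[OF \<phi> \<open>0 < a\<close> lim]
  define E where "E x = (deriv \<phi> x)\<^sup>2 - (\<phi> x)\<^sup>2 + 2 * (a / c) * slope c (\<phi> x)" for x
  have "(E has_real_derivative 0) (at x)" for x
  proof -
    have "((\<lambda>x. slope c (\<phi> x)) has_real_derivative c / sqrt (c - (\<phi> x)\<^sup>2) ^ 3 * deriv \<phi> x) (at x)"
      by (rule DERIV_chain2[OF DERIV_slope d(1)]) (rule d(3))
    then show ?thesis
      unfolding E_def using \<open>0 < c\<close>
      by (auto intro!: derivative_eq_intros d(1,2) simp: restoring_force_def field_simps)
  qed
  then have const: "E y = E x" for y
    using DERIV_isconst_all by blast
  have sl: "((\<lambda>y. slope c (\<phi> y)) \<longlongrightarrow> t) at_top"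
    unfolding t_def slope_def using l(1) by (intro tendsto_intros lim) auto
  \<comment> \<open>Constancy of \<open>E\<close> makes the square of the derivative converge. Its
    limit must be 0 because \<phi> converges, and this evaluates the constant.\<close>
  have "((\<lambda>y. E x + (\<phi> y)\<^sup>2 - 2 * (a / c) * slope c (\<phi> y)) \<longlongrightarrow>
      E x + l\<^sup>2 - 2 * (a / c) * t) at_top"
    by (intro tendsto_intros lim sl)
  moreover have "E x + (\<phi> y)\<^sup>2 - 2 * (a / c) * slope c (\<phi> y) = (deriv \<phi> y)\<^sup>2" for y
    using const[of y] by (simp add: E_def)
  ultimately have "((\<lambda>y. (deriv \<phi> y)\<^sup>2) \<longlongrightarrow> E x + l\<^sup>2 - 2 * (a / c) * t) at_top"
    by simp
  then have "E x + l\<^sup>2 - 2 * (a / c) * t = 0"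
    by (rule derivative_square_limit_eq_0[OF d(1) lim])
  then have 1: "(deriv \<phi> x)\<^sup>2 = (\<phi> x)\<^sup>2 - l\<^sup>2 - 2 * (a / c) * (\<tau> - t)"
    by (simp add: E_def \<tau>_def algebra_simps diff_divide_distrib)
  have pos: "0 < 1 + t\<^sup>2" "0 < 1 + \<tau>\<^sup>2" by (simp_all add: add_pos_nonneg)
  have phi_eq: "(\<phi> x)\<^sup>2 = c * \<tau>\<^sup>2 / (1 + \<tau>\<^sup>2)"
    using height_square[OF \<open>0 < c\<close>] height_slope[OF d(3)] unfolding \<tau>_def by metis
  have l_eq: "l\<^sup>2 = c * t\<^sup>2 / (1 + t\<^sup>2)"
    using height_square[OF \<open>0 < c\<close>] height_slope[OF l(1)] unfolding t_def by metis
  \<comment> \<open>This is the equilibrium condition at \<open>l\<close>, rewritten in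
    \<open>t\<close>; with it the first integral is rational in \<tau> and t.\<close>
  have a_eq: "a = c\<^sup>2 * t / (1 + t\<^sup>2)\<^sup>2"
  proof -
    define q where "q = sqrt (c - l\<^sup>2)"
    have q: "0 < q" "q\<^sup>2 = c - l\<^sup>2" using l(1) by (simp_all add: q_def)
    have "1 + t\<^sup>2 = c / q\<^sup>2" using one_plus_slope_square[OF l(1)] q by (simp add: t_def)
    then have "c\<^sup>2 * t / (1 + t\<^sup>2)\<^sup>2 = l * q ^ 3"
      using q(1) \<open>0 < c\<close>
      by (simp add: t_def slope_def flip: q_def) (simp add: field_simps eval_nat_numeral)
    also have "\<dots> = a" using l restoring_force_eq_0_iff by (simp add: q_def)
    finally show ?thesis by simp
  qed
  show ?thesis
    unfolding 1 phi_eq l_eq a_eq using pos \<open>0 < c\<close>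
    by (simp add: divide_simps) algebra
qed

text \<open>Positivity of \<open>a\<close> gives l > 0. The value sqrt c / 2 would force
  \<open>a\<close> to equal its excluded upper bound, and beyond it the first integral leaves no
  room to approach \<open>l\<close>.\<close>

lemma novikov_end_state_bounds:
  assumes \<phi>: "novikov_profile c a \<phi>" and a: "0 < a" "a < 3 * sqrt 3 * c\<^sup>2 / 16" and "0 < c"
    and lim: "(\<phi> \<longlongrightarrow> l) at_top"
  shows "0 < l" and "l < sqrt c / 2"
proof -
  note l = novikov_end_state_equilibrium[OF \<phi> a(1) lim]
  have a_eq: "a = l * sqrt (c - l\<^sup>2) ^ 3"
    using l restoring_force_eq_0_iff by blast
  show "0 < l" using a(1) l(1) unfolding a_eq by (simp add: zero_less_mult_iff)
  then have l2: "3 * (slope c l)\<^sup>2 < 1 \<longleftrightarrow> l < sqrt c / 2"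
    using slope_square_less_iff l(1) \<open>0 < c\<close> by blast
  show "l < sqrt c / 2"
  proof (rule ccontr)
    assume "\<not> l < sqrt c / 2"
    then have "sqrt c / 2 \<le> l" "1 \<le> 3 * (slope c l)\<^sup>2" using l2 by auto
    then consider "l = sqrt c / 2" | "1 < 3 * (slope c l)\<^sup>2"
      using slope_square_eq_third[OF \<open>0 < l\<close> l(1)] by linarith
    then show False
    proof cases
      case 1
      have "c - l\<^sup>2 = c * (3 / 4)" using \<open>0 < c\<close> by (simp add: 1 power_divide)
      then have q: "sqrt (c - l\<^sup>2) = sqrt c * sqrt 3 / 2"
        by (simp add: real_sqrt_mult real_sqrt_divide)
      have "a = sqrt c / 2 * (sqrt c * sqrt 3 / 2) ^ 3"
        unfolding a_eq q by (simp add: 1)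
      also have "\<dots> = (sqrt c)\<^sup>2 * (sqrt c)\<^sup>2 * (sqrt 3)\<^sup>2 * sqrt 3 / 16"
        by (simp only: power3_eq_cube power2_eq_square times_divide_eq_left times_divide_eq_right
            divide_divide_eq_left ac_simps)
      finally show False using a(2) \<open>0 < c\<close> by (simp add: power2_eq_square)
    next
      \<comment> \<open>The last factor of the first integral tends to 1 - 3 t^2 < 0. Once it is
        negative, a nonnegative square forces \<tau> = t and \<phi>' = 0, so the profile would be
        the constant \<open>l\<close>.\<close>
      case 2
      define t where "t = slope c l"
      have "((\<lambda>y. slope c (\<phi> y)) \<longlongrightarrow> t) at_top"
        unfolding t_def slope_def using l(1) by (intro tendsto_intros lim) auto
      then have "((\<lambda>y. 1 - t\<^sup>2 - 2 * t * slope c (\<phi> y)) \<longlongrightarrow> 1 - t\<^sup>2 - 2 * t * t) at_top"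
        by (intro tendsto_intros)
      moreover have "1 - t\<^sup>2 - 2 * t * t < 0" using 2 by (simp add: t_def power2_eq_square)
      ultimately have "\<forall>\<^sub>F y in at_top. 1 - t\<^sup>2 - 2 * t * slope c (\<phi> y) < 0"
        by (rule order_tendstoD(2))
      then obtain y where y: "1 - t\<^sup>2 - 2 * t * slope c (\<phi> y) < 0"
        using eventually_happens' trivial_limit_at_top_linorder by blast
      note I = novikov_first_integral[OF \<phi> a(1) \<open>0 < c\<close> lim, of y, folded t_def]
      have "slope c (\<phi> y) = t"
      proof (rule ccontr)
        assume "slope c (\<phi> y) \<noteq> t"
        then have "c * (slope c (\<phi> y) - t)\<^sup>2 * (1 - t\<^sup>2 - 2 * t * slope c (\<phi> y)) < 0"
          using y \<open>0 < c\<close> by (intro mult_pos_neg) auto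
        moreover have "0 < (1 + (slope c (\<phi> y))\<^sup>2) * (1 + t\<^sup>2)\<^sup>2"
          by (intro mult_pos_pos zero_less_power add_pos_nonneg) auto
        ultimately have "(deriv \<phi> y)\<^sup>2 < 0" unfolding I by (rule divide_neg_pos)
        then show False by simp
      qed
      then have "deriv \<phi> y = 0" and "slope c (\<phi> y) = slope c l"
        using I by (simp, simp only: t_def)
      moreover have "\<phi> y = l"
        using height_slope[OF novikov_profile_deriv(3)[OF \<phi>, of y]] height_slope[OF l(1)]
        unfolding calculation(2) by (rule trans[OF sym])
      ultimately show False using novikov_profile_not_equilibrium[OF \<phi> l(2,1)] by blast
    qed
  qed
qed

text \<open>The end state fixes the coefficient through the equilibrium condition. At the critical
  point 0 the first integral vanishes; its double zero is the equilibrium, which is excluded, so the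
  height is given by the remaining factor, and initial data agree.\<close>

lemma novikov_profile_eq:
  assumes \<phi>: "novikov_profile c a \<phi>" and a: "0 < a" "(\<phi> \<longlongrightarrow> l) at_top"
    and \<psi>: "novikov_profile c b \<psi>" and b: "0 < b" "(\<psi> \<longlongrightarrow> l) at_top"
    and "0 < c"
  shows "\<phi> = \<psi>"
proof -
  note l = novikov_end_state_equilibrium[OF \<phi> a]
  have "a = b"
    using l novikov_end_state_equilibrium[OF \<psi> b] restoring_force_eq_0_iff by metis
  have "l \<noteq> 0" using l \<open>0 < a\<close> by (auto simp: restoring_force_eq_0_iff)
  then have t0: "slope c l \<noteq> 0" using l(1) by (simp add: slope_def)
  have crest: "slope c (\<eta> 0) = (1 - (slope c l)\<^sup>2) / (2 * slope c l)"
    if \<eta>: "novikov_profile c a \<eta>" and lim: "(\<eta> \<longlongrightarrow> l) at_top" for \<eta>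
  proof -
    define \<tau> t where "\<tau> = slope c (\<eta> 0)" and "t = slope c l"
    have d0: "deriv \<eta> 0 = 0" using \<eta> by (simp add: novikov_profile_def)
    have pos: "0 < 1 + t\<^sup>2" "0 < 1 + \<tau>\<^sup>2" by (simp_all add: add_pos_nonneg)
    have "\<tau> \<noteq> t"
      using novikov_profile_not_equilibrium[OF \<eta> l(2,1) d0]
        height_slope[OF novikov_profile_deriv(3)[OF \<eta>, of 0]] height_slope[OF l(1)]
      unfolding \<tau>_def t_def by metis
    then have "1 - t\<^sup>2 - 2 * t * \<tau> = 0"
      using novikov_first_integral[OF \<eta> \<open>0 < a\<close> \<open>0 < c\<close> lim, of 0, folded \<tau>_def t_def] pos \<open>0 < c\<close>
      by (simp add: d0)
    then show ?thesis using t0 by (fold \<tau>_def t_def) (simp add: field_simps)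
  qed
  have "slope c (\<phi> 0) = slope c (\<psi> 0)"
    using crest \<phi> a(2) \<psi> b(2) \<open>a = b\<close> by simp
  then have "\<phi> 0 = \<psi> 0"
    using height_slope[OF novikov_profile_deriv(3)[OF \<phi>, of 0]]
      height_slope[OF novikov_profile_deriv(3)[OF \<psi>, of 0]] by metis
  moreover have "deriv \<phi> 0 = deriv \<psi> 0"
    using \<phi> \<psi> by (simp add: novikov_profile_def)
  ultimately show ?thesis
    using novikov_profile_unique[OF \<phi>] novikov_profile_deriv[OF \<psi>] \<open>a = b\<close> by blast
qed

section \<open>The orbit in closed form\<close>

text \<open>
  \<open>position w t\<close> is the antiderivative in \<open>w\<close> of \<open>1 / w'\<close> vanishing at \<open>w = 0\<close>, where \<open>w\<close>
  is the signed square root of the factor \<open>1 - t\<^sup>2 - 2 * t * \<tau>\<close> of the first integral.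
\<close>
definition position :: "real \<Rightarrow> real \<Rightarrow> real" where
  "position w t =
     (ln (sqrt (1 - 3 * t\<^sup>2) + w) - ln (sqrt (1 - 3 * t\<^sup>2) - w)) / sqrt (1 - 3 * t\<^sup>2) +
     (ln ((1 - w)\<^sup>2 + t\<^sup>2) - ln ((1 + w)\<^sup>2 + t\<^sup>2)) / 2"

text \<open>Points are pairs (w, t). The boundary values w = \<plusminus> sqrt(1 - 3 t^2) correspond
  to \<tau> = t, the end state, approached only as x tends to infinity in either direction.\<close>

definition orbit_domain :: "(real \<times> real) set" where
  "orbit_domain = {p. 0 < snd p \<and> (fst p)\<^sup>2 + 3 * (snd p)\<^sup>2 < 1}"

text \<open>The derivative w' along the wave as a function of \<open>w\<close>, taken from the first
  integral with the sign for which \<open>w\<close> increases. The product of the two quadratics is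
  4 t^2 (1 + \<tau>^2) with \<tau> = (1 - t^2 - w^2) / (2 t).\<close>

definition orbit_speed :: "real \<Rightarrow> real \<Rightarrow> real" where
  "orbit_speed w t =
     (1 - 3 * t\<^sup>2 - w\<^sup>2) * (((1 - w)\<^sup>2 + t\<^sup>2) * ((1 + w)\<^sup>2 + t\<^sup>2)) / (8 * t\<^sup>2 * (1 + t\<^sup>2))"

lemma mem_orbit_domain:
  "(w, t) \<in> orbit_domain \<longleftrightarrow> 0 < t \<and> 3 * t\<^sup>2 < 1 \<and> \<bar>w\<bar> < sqrt (1 - 3 * t\<^sup>2)"
proof -
  have "w\<^sup>2 < 1 - 3 * t\<^sup>2 \<longleftrightarrow> \<bar>w\<bar> < sqrt (1 - 3 * t\<^sup>2)"
    using real_sqrt_less_iff[of "w\<^sup>2" "1 - 3 * t\<^sup>2"] by simp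
  moreover have "w\<^sup>2 < 1 - 3 * t\<^sup>2 \<Longrightarrow> 3 * t\<^sup>2 < 1"
    using zero_le_power2[of w] by linarith
  ultimately show ?thesis by (auto simp: orbit_domain_def)
qed

lemma open_orbit_domain: "open orbit_domain"
  unfolding orbit_domain_def
  by (intro open_Collect_conj open_Collect_less continuous_intros)

lemma orbit_speed_pos: "(w, t) \<in> orbit_domain \<Longrightarrow> 0 < orbit_speed w t"
  unfolding orbit_speed_def orbit_domain_def
  by (auto intro!: divide_pos_pos mult_pos_pos add_nonneg_pos)

text \<open>This is the partial fraction decomposition of the reciprocal speed: over the common
  denominator the numerators combine to 8 t^2 (1 + t^2), which is free of \<open>w\<close>.\<close>

lemma DERIV_position:
  assumes "(w, t) \<in> orbit_domain"
  shows "((\<lambda>w. position w t) has_real_derivative 1 / orbit_speed w t) (at w)"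
proof -
  define r where "r = sqrt (1 - 3 * t\<^sup>2)"
  have t: "0 < t" "3 * t\<^sup>2 < 1" and w: "\<bar>w\<bar> < r"
    using assms by (auto simp: mem_orbit_domain r_def)
  have r: "0 < r" "r\<^sup>2 = 1 - 3 * t\<^sup>2" using t by (simp_all add: r_def)
  define A B where "A = (1 - w)\<^sup>2 + t\<^sup>2" and "B = (1 + w)\<^sup>2 + t\<^sup>2"
  have pos: "0 < r + w" "0 < r - w" "0 < A" "0 < B"
    using w t by (auto simp: A_def B_def intro!: add_nonneg_pos)
  have D: "((\<lambda>w. position w t) has_real_derivative
      (1 / (r + w) + 1 / (r - w)) / r + (- (2 * (1 - w)) / A - 2 * (1 + w) / B) / 2) (at w)"
    unfolding position_def A_def B_def r_def[symmetric]
    by (rule derivative_eq_intros refl | use pos in \<open>simp add: A_def B_def\<close>)+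
  have 1: "(1 / (r + w) + 1 / (r - w)) / r = 2 / (r\<^sup>2 - w\<^sup>2)"
  proof -
    have "r\<^sup>2 - w\<^sup>2 = (r + w) * (r - w)" by (simp add: power2_eq_square algebra_simps)
    then show ?thesis using pos r by (simp add: divide_simps)
  qed
  have 2: "(- (2 * (1 - w)) / A - 2 * (1 + w) / B) / 2 = - ((1 - w) * B + (1 + w) * A) / (A * B)"
    using pos by (simp add: divide_simps) (simp add: algebra_simps)
  have gap: "0 < r\<^sup>2 - w\<^sup>2" using pos by (simp add: power2_eq_square square_diff_square_factored)
  have "2 * (A * B) - ((1 - w) * B + (1 + w) * A) * (r\<^sup>2 - w\<^sup>2) = 8 * t\<^sup>2 * (1 + t\<^sup>2)"
    unfolding A_def B_def r(2) by algebra
  then have "2 / (r\<^sup>2 - w\<^sup>2) + - ((1 - w) * B + (1 + w) * A) / (A * B) =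
      8 * t\<^sup>2 * (1 + t\<^sup>2) / ((r\<^sup>2 - w\<^sup>2) * (A * B))"
    using pos(3,4) gap by (simp add: divide_simps) (simp add: algebra_simps)
  then have "(1 / (r + w) + 1 / (r - w)) / r + (- (2 * (1 - w)) / A - 2 * (1 + w) / B) / 2
      = 1 / orbit_speed w t"
    unfolding 1 2 by (simp add: orbit_speed_def A_def B_def r(2))
  then show ?thesis using D by simp
qed

lemma position_minus: "position (- w) t = - position w t"
  by (simp add: position_def diff_divide_distrib)

lemma position_strict_mono:
  assumes "(v, t) \<in> orbit_domain" "(w, t) \<in> orbit_domain" "v < w"
  shows "position v t < position w t"
proof (rule DERIV_pos_imp_increasing[OF \<open>v < w\<close>])
  fix u assume "v \<le> u" "u \<le> w"
  then have "(u, t) \<in> orbit_domain" using assms by (auto simp: mem_orbit_domain)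
  then show "\<exists>y. ((\<lambda>w. position w t) has_real_derivative y) (at u) \<and> 0 < y"
    using DERIV_position orbit_speed_pos by (metis zero_less_divide_1_iff)
qed

text \<open>The first summand of \<open>position\<close> blows up at the end of the range of
  \<open>w\<close>, while the second is bounded below for w \<ge> 0. So some \<open>w\<close> has
  position at least |x|, and oddness and the intermediate value theorem give
  \<open>x\<close>.\<close>

lemma position_surj:
  assumes "0 < t" "3 * t\<^sup>2 < 1"
  shows "\<exists>w. (w, t) \<in> orbit_domain \<and> position w t = x"
proof -
  define r where "r = sqrt (1 - 3 * t\<^sup>2)"
  have r: "0 < r" "r \<le> 1" using assms by (simp_all add: r_def)
  \<comment> \<open>A lower bound of the second summand for 0 \<le> w \<le> 1 and t^2 < 1: the
    numerator is at least t^2 and the denominator at most 5.\<close>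
  define M where "M = (ln (t\<^sup>2) - ln 5) / 2"
  \<comment> \<open>Chosen so that at w = r tanh y the first summand, 2 y / r, equals |x| -
    M.\<close>
  define y where "y = r * (\<bar>x\<bar> - M) / 2"
  define w where "w = r * tanh y"
  have t1: "t\<^sup>2 < 1" "0 < t\<^sup>2" using assms by auto
  then have "ln (t\<^sup>2) < ln 5" by simp
  then have "M < 0" by (simp add: M_def)
  then have "0 \<le> y" using r by (simp add: y_def)
  have tanh: "\<bar>tanh y\<bar> < 1" using tanh_real_bounds[of y] by auto
  have w: "0 \<le> w" "\<bar>w\<bar> < r"
    using \<open>0 \<le> y\<close> r tanh by (auto simp: w_def abs_mult)
  have dom: "(v, t) \<in> orbit_domain" if "\<bar>v\<bar> \<le> w" for v
    using that w assms by (auto simp: mem_orbit_domain r_def)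
  have "\<bar>x\<bar> \<le> position w t"
  proof -
    have pos: "0 < 1 + tanh y" "0 < 1 - tanh y" using tanh by auto
    have "r + w = r * (1 + tanh y)" "r - w = r * (1 - tanh y)"
      by (simp_all add: w_def algebra_simps)
    then have "ln (r + w) - ln (r - w) = ln (1 + tanh y) - ln (1 - tanh y)"
      using r pos by (simp add: ln_mult)
    also have "\<dots> = 2 * artanh (tanh y)"
      using pos by (simp add: artanh_def ln_div)
    also have "\<dots> = 2 * y" by (simp add: artanh_tanh_real)
    finally have "(ln (r + w) - ln (r - w)) / r = \<bar>x\<bar> - M"
      using r by (simp add: y_def)
    moreover have "ln (t\<^sup>2) \<le> ln ((1 - w)\<^sup>2 + t\<^sup>2)" using t1 by (simp add: add_nonneg_pos)
    moreover have "ln ((1 + w)\<^sup>2 + t\<^sup>2) \<le> ln 5"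
    proof -
      have "(1 + w)\<^sup>2 \<le> 2\<^sup>2" using w r by (intro power_mono) auto
      then have "(1 + w)\<^sup>2 + t\<^sup>2 \<le> 5" using t1 by simp
      moreover have "0 < (1 + w)\<^sup>2 + t\<^sup>2" using t1 by (simp add: add_nonneg_pos)
      ultimately show ?thesis by simp
    qed
    ultimately show ?thesis
      unfolding position_def r_def[symmetric] by (simp add: M_def field_simps)
  qed
  then have "position (- w) t \<le> x" "x \<le> position w t"
    unfolding position_minus by auto
  moreover have "isCont (\<lambda>w. position w t) v" if "- w \<le> v" "v \<le> w" for v
    by (rule DERIV_isCont[OF DERIV_position[OF dom]]) (use that in auto)
  ultimately obtain v where "- w \<le> v" "v \<le> w" "position v t = x"
    using IVT[of "\<lambda>w. position w t" "- w" x w] w by auto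
  then show ?thesis using dom by (intro exI[of _ v]) auto
qed

text \<open>The inverse of \<open>position\<close> in \<open>w\<close>; strict monotonicity makes
  the choice unique where it is used. Taking the pair (x, t) as argument fits the implicit function
  theorem.\<close>

definition orbit :: "real \<times> real \<Rightarrow> real" where
  "orbit q = (SOME w. (w, snd q) \<in> orbit_domain \<and> position w (snd q) = fst q)"

lemma orbit:
  assumes "0 < t" "3 * t\<^sup>2 < 1"
  shows orbit_in_domain: "(orbit (x, t), t) \<in> orbit_domain"
    and position_orbit: "position (orbit (x, t)) t = x"
  using someI_ex[OF position_surj[OF assms, of x]] by (auto simp: orbit_def)

lemma orbit_position:
  assumes "(w, t) \<in> orbit_domain"
  shows "orbit (position w t, t) = w"
proof -
  have t: "0 < t" "3 * t\<^sup>2 < 1" using assms by (auto simp: mem_orbit_domain)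
  show ?thesis
    using orbit[OF t, of "position w t"] assms position_strict_mono
    by (metis less_irrefl linorder_neqE_linordered_idom)
qed

lemma orbit_eqI: "(w, t) \<in> orbit_domain \<Longrightarrow> position w t = x \<Longrightarrow> orbit (x, t) = w"
  using orbit_position by blast

text \<open>Reduces the nondegeneracy condition of the implicit function theorem to the one-variable
  derivative of \<open>position\<close>.\<close>

lemma frechet_derivative_fst_direction:
  fixes F :: "real \<times> real \<Rightarrow> real"
  assumes "F differentiable at (w, t)" "((\<lambda>u. F (u, t)) has_real_derivative D) (at w)"
  shows "frechet_derivative F (at (w, t)) (1, 0) = D"
proof -
  have "((\<lambda>u. (u, t)) has_derivative (\<lambda>h. (h, 0))) (at w)"
    by (intro has_derivative_Pair has_derivative_ident has_derivative_const)
  from has_derivative_compose[OF this] assms(1)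
  have "((\<lambda>u. F (u, t)) has_derivative (\<lambda>h. frechet_derivative F (at (w, t)) (h, 0))) (at w)"
    by (simp add: frechet_derivative_works)
  from has_derivative_unique[OF this assms(2)[unfolded has_field_derivative_def]]
  show ?thesis by (metis mult.right_neutral)
qed

lemma smooth_on_position: "smooth_on (\<lambda>p. position (fst p) (snd p)) orbit_domain"
proof -
  have pos: "0 < 1 - 3 * (snd p)\<^sup>2" "0 < sqrt (1 - 3 * (snd p)\<^sup>2) + fst p"
    "0 < sqrt (1 - 3 * (snd p)\<^sup>2) - fst p" "0 < (1 - fst p)\<^sup>2 + (snd p)\<^sup>2"
    "0 < (1 + fst p)\<^sup>2 + (snd p)\<^sup>2" "sqrt (1 - 3 * (snd p)\<^sup>2) \<noteq> 0" if "p \<in> orbit_domain" for p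
  proof -
    have "0 < snd p" "3 * (snd p)\<^sup>2 < 1" "\<bar>fst p\<bar> < sqrt (1 - 3 * (snd p)\<^sup>2)"
      using that mem_orbit_domain[of "fst p" "snd p"] by auto
    then show "0 < 1 - 3 * (snd p)\<^sup>2" "0 < sqrt (1 - 3 * (snd p)\<^sup>2) + fst p"
      "0 < sqrt (1 - 3 * (snd p)\<^sup>2) - fst p" "0 < (1 - fst p)\<^sup>2 + (snd p)\<^sup>2"
      "0 < (1 + fst p)\<^sup>2 + (snd p)\<^sup>2" "sqrt (1 - 3 * (snd p)\<^sup>2) \<noteq> 0"
      by (auto simp: abs_less_iff intro!: add_nonneg_pos)
  qed
  show ?thesis
    unfolding position_def
    by (intro smooth_on_intros open_orbit_domain) (use pos in simp_all)
qed

lemma smooth_on_orbit: "smooth_on orbit {q. 0 < snd q \<and> 3 * (snd q)\<^sup>2 < 1}"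
proof (rule smooth_on_implicit[OF smooth_on_position])
  show "open {q :: real \<times> real. 0 < snd q \<and> 3 * (snd q)\<^sup>2 < 1}"
    by (intro open_Collect_conj open_Collect_less continuous_intros)
  fix p assume p: "p \<in> orbit_domain"
  obtain w t where wt: "p = (w, t)" by fastforce
  have "(\<lambda>p. position (fst p) (snd p)) differentiable at p"
    using smooth_on_position p unfolding smooth_on_def by (auto dest!: spec[of _ "Suc 0"])
  then have "frechet_derivative (\<lambda>p. position (fst p) (snd p)) (at p) (1, 0) = 1 / orbit_speed w t"
    using DERIV_position p unfolding wt by (intro frechet_derivative_fst_direction) auto
  then show "frechet_derivative (\<lambda>p. position (fst p) (snd p)) (at p) (1, 0) \<noteq> 0"
    using orbit_speed_pos[of w t] p by (simp add: wt)
qed (auto simp: orbit orbit_position)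

section \<open>The orbit as a function of \<open>x\<close> for fixed \<open>t\<close>\<close>

lemma smooth_on_orbit_section:
  assumes "0 < t" "3 * t\<^sup>2 < 1"
  shows "smooth_on (\<lambda>x. orbit (x, t)) UNIV"
  by (rule smooth_on_compose[OF _ smooth_on_orbit]) (use assms in \<open>auto intro!: smooth_on_intros\<close>)

text \<open>Differentiability is already known from joint smoothness; differentiating
  \<open>position (orbit (x, t)) t = x\<close> then identifies the value.\<close>

lemma DERIV_orbit:
  assumes "0 < t" "3 * t\<^sup>2 < 1"
  shows "((\<lambda>x. orbit (x, t)) has_real_derivative orbit_speed (orbit (x, t)) t) (at x)"
proof -
  have "Ck_on (Suc 0) (\<lambda>x. orbit (x, t)) UNIV"
    using smooth_on_orbit_section[OF assms] unfolding smooth_on_def by blast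
  from Ck_on_Suc_realD(1)[OF open_UNIV this]
  have d: "((\<lambda>x. orbit (x, t)) has_real_derivative deriv (\<lambda>x. orbit (x, t)) x) (at x)" by simp
  note dom = orbit_in_domain[OF assms, of x]
  have "((\<lambda>x. position (orbit (x, t)) t) has_real_derivative
      1 / orbit_speed (orbit (x, t)) t * deriv (\<lambda>x. orbit (x, t)) x) (at x)"
    by (rule DERIV_chain2[OF DERIV_position[OF dom] d])
  then have "1 / orbit_speed (orbit (x, t)) t * deriv (\<lambda>x. orbit (x, t)) x = 1"
    unfolding position_orbit[OF assms] by (rule DERIV_unique[OF _ DERIV_ident])
  then show ?thesis using d orbit_speed_pos[OF dom] by (simp add: field_simps)
qed

lemma orbit_minus:
  assumes "0 < t" "3 * t\<^sup>2 < 1"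
  shows "orbit (- x, t) = - orbit (x, t)"
  using orbit[OF assms, of x] by (intro orbit_eqI) (auto simp: mem_orbit_domain position_minus)

lemma orbit_tendsto:
  assumes t: "0 < t" "3 * t\<^sup>2 < 1"
  shows "((\<lambda>x. orbit (x, t)) \<longlongrightarrow> sqrt (1 - 3 * t\<^sup>2)) at_top"
proof (rule order_tendstoI)
  note dom = orbit_in_domain[OF t]
  fix a
  show "\<forall>\<^sub>F x in at_top. orbit (x, t) < a" if "sqrt (1 - 3 * t\<^sup>2) < a"
  proof (rule always_eventually, rule allI)
    show "orbit (x, t) < a" for x
      using that abs_ge_self[of "orbit (x, t)"] dom[of x] unfolding mem_orbit_domain by linarith
  qed
  show "\<forall>\<^sub>F x in at_top. a < orbit (x, t)" if "a < sqrt (1 - 3 * t\<^sup>2)"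
  proof -
    \<comment> \<open>Truncation at 0 keeps \<open>w\<close> in the domain even when
      \<open>a\<close> lies below - sqrt(1 - 3 t^2).\<close>
    define w where "w = max a 0"
    have w: "(w, t) \<in> orbit_domain"
      using that t by (simp add: w_def mem_orbit_domain)
    have "a < orbit (x, t)" if "position w t < x" for x
    proof -
      have "w < orbit (x, t)"
        using that position_strict_mono[OF dom w, of x] position_orbit[OF t, of x]
        by (metis less_asym linorder_neqE_linordered_idom)
      then show ?thesis by (simp add: w_def)
    qed
    then show ?thesis
      by (rule eventually_mono[OF eventually_gt_at_top[of "position w t"]])
  qed
qed

text \<open>Solves w^2 = 1 - t^2 - 2 t \<tau> for \<tau>. It is even in \<open>w\<close>, which
  makes the wave even in \<open>x\<close>, with its crest at w = 0.\<close>

definition orbit_slope :: "real \<Rightarrow> real \<Rightarrow> real" where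
  "orbit_slope t w = (1 - t\<^sup>2 - w\<^sup>2) / (2 * t)"

definition soliton :: "real \<Rightarrow> real \<Rightarrow> real \<Rightarrow> real" where
  "soliton c t x = height c (orbit_slope t (orbit (x, t)))"

lemma soliton_end_state:
  assumes t: "0 < t" "3 * t\<^sup>2 < 1"
  shows "has_end_state (soliton c t) (height c t)"
proof -
  have nz: "sqrt (1 + (orbit_slope t w)\<^sup>2) \<noteq> 0" for w
    using add_pos_nonneg[of 1 "(orbit_slope t w)\<^sup>2"] by simp
  have "(soliton c t \<longlongrightarrow> height c (orbit_slope t (sqrt (1 - 3 * t\<^sup>2)))) at_top"
    unfolding soliton_def[abs_def] height_def orbit_slope_def
    by (intro tendsto_intros orbit_tendsto t nz[unfolded orbit_slope_def]) (use t in auto)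
  moreover have "orbit_slope t (sqrt (1 - 3 * t\<^sup>2)) = t"
    using t by (simp add: orbit_slope_def field_simps power2_eq_square)
  ultimately have lim: "(soliton c t \<longlongrightarrow> height c t) at_top" by simp
  have "soliton c t (- x) = soliton c t x" for x
    by (simp add: soliton_def orbit_minus[OF t] orbit_slope_def)
  then have "(soliton c t \<longlongrightarrow> height c t) at_bot"
    using lim by (simp add: filterlim_at_bot_mirror)
  then show ?thesis using lim by (simp add: has_end_state_def)
qed

lemma orbit_speed_eq:
  fixes w t :: real
  assumes "0 < t"
  defines "\<tau> \<equiv> orbit_slope t w"
  shows "orbit_speed w t = t * (\<tau> - t) * (1 + \<tau>\<^sup>2) / (1 + t\<^sup>2)"
proof -
  have pos: "0 < 1 + t\<^sup>2" by (simp add: add_pos_nonneg)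
  have 1: "1 - 3 * t\<^sup>2 - w\<^sup>2 = 2 * t * (\<tau> - t)"
    using assms by (simp add: orbit_slope_def field_simps power2_eq_square)
  have 2: "((1 - w)\<^sup>2 + t\<^sup>2) * ((1 + w)\<^sup>2 + t\<^sup>2) = 4 * t\<^sup>2 * (1 + \<tau>\<^sup>2)"
  proof -
    have "2 * t * \<tau> = 1 - t\<^sup>2 - w\<^sup>2" using assms by (simp add: orbit_slope_def)
    then show ?thesis by algebra
  qed
  show ?thesis
    unfolding orbit_speed_def 1 2 using assms(1) pos by (simp add: divide_simps)
qed

section \<open>The profile\<close>

text \<open>Here \<open>w\<close> plays the part of the signed square root in the first integral, so
  \<tau> passes smoothly through its turning point at w = 0.\<close>

lemma DERIV_orbit_slope:
  fixes x t :: real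
  assumes t: "0 < t" "3 * t\<^sup>2 < 1"
  defines "w \<equiv> orbit (x, t)" and "\<tau> \<equiv> orbit_slope t (orbit (x, t))"
  shows "((\<lambda>x. orbit_slope t (orbit (x, t))) has_real_derivative
    - w * (\<tau> - t) * (1 + \<tau>\<^sup>2) / (1 + t\<^sup>2)) (at x)"
proof -
  have dw: "((\<lambda>x. orbit (x, t)) has_real_derivative t * (\<tau> - t) * (1 + \<tau>\<^sup>2) / (1 + t\<^sup>2)) (at x)"
    using DERIV_orbit[OF t, of x] orbit_speed_eq[OF t(1), of w] by (simp add: w_def \<tau>_def)
  have "(orbit_slope t has_real_derivative - w / t) (at w)"
    unfolding orbit_slope_def using t by (auto intro!: derivative_eq_intros)
  from DERIV_chain2[OF this[unfolded w_def] dw]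
  show ?thesis using t by (simp add: w_def mult.assoc)
qed

lemma DERIV_sqrt_one_plus_square:
  "((\<lambda>\<tau>. sqrt (1 + \<tau>\<^sup>2)) has_real_derivative \<tau> / sqrt (1 + \<tau>\<^sup>2)) (at \<tau>)"
proof -
  have "0 < 1 + \<tau>\<^sup>2" by (simp add: add_pos_nonneg)
  then show ?thesis by (auto intro!: derivative_eq_intros simp: divide_simps)
qed

lemma DERIV_height: "(height c has_real_derivative sqrt c / sqrt (1 + \<tau>\<^sup>2) ^ 3) (at \<tau>)"
proof -
  define q where "q = sqrt (1 + \<tau>\<^sup>2)"
  have pos: "0 < 1 + \<tau>\<^sup>2" by (simp add: add_pos_nonneg)
  then have q: "0 < q" "q * q = 1 + \<tau>\<^sup>2" by (simp_all add: q_def)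
  have "sqrt (1 + \<tau>\<^sup>2) \<noteq> 0" using pos by simp
  from DERIV_divide[OF DERIV_cmult[OF DERIV_ident, of "sqrt c"] DERIV_sqrt_one_plus_square this]
  have "(height c has_real_derivative
      (sqrt c * 1 * q - sqrt c * \<tau> * (\<tau> / q)) / (q * q)) (at \<tau>)"
    unfolding height_def[abs_def] q_def .
  also have "(sqrt c * 1 * q - sqrt c * \<tau> * (\<tau> / q)) / (q * q) = sqrt c * (q * q - \<tau>\<^sup>2) / q ^ 3"
    using q(1) by (simp add: field_simps power3_eq_cube power2_eq_square)
  finally show ?thesis by (simp add: q(2)) (simp add: q_def)
qed

text \<open>A signed square root of the first integral, with \<open>w\<close> carrying the sign
  change at the crest.\<close>

definition soliton_deriv :: "real \<Rightarrow> real \<Rightarrow> real \<Rightarrow> real" where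
  "soliton_deriv c t x =
     orbit (x, t) * (orbit_slope t (orbit (x, t)) - t) / sqrt (1 + (orbit_slope t (orbit (x, t)))\<^sup>2) *
     (- sqrt c / (1 + t\<^sup>2))"

lemma DERIV_soliton:
  assumes t: "0 < t" "3 * t\<^sup>2 < 1"
  shows "(soliton c t has_real_derivative soliton_deriv c t x) (at x)"
proof -
  define w \<tau> where "w = orbit (x, t)" and "\<tau> = orbit_slope t (orbit (x, t))"
  define q where "q = sqrt (1 + \<tau>\<^sup>2)"
  have pos: "0 < 1 + t\<^sup>2" "0 < 1 + \<tau>\<^sup>2" by (simp_all add: add_pos_nonneg)
  then have q: "0 < q" "1 + \<tau>\<^sup>2 = q\<^sup>2" by (simp_all add: q_def)
  have "(soliton c t has_real_derivative
      sqrt c / q ^ 3 * (- w * (\<tau> - t) * (1 + \<tau>\<^sup>2) / (1 + t\<^sup>2))) (at x)"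
    unfolding soliton_def[abs_def] w_def \<tau>_def q_def
    by (rule DERIV_chain2[OF DERIV_height DERIV_orbit_slope[OF t]])
  also have "sqrt c / q ^ 3 * (- w * (\<tau> - t) * (1 + \<tau>\<^sup>2) / (1 + t\<^sup>2)) =
      w * (\<tau> - t) / q * (- sqrt c / (1 + t\<^sup>2))"
    unfolding q(2) using q(1) pos(1) by (simp add: divide_simps) (simp add: power3_eq_cube power2_eq_square)
  finally show ?thesis by (simp add: soliton_deriv_def w_def \<tau>_def q_def)
qed

lemma restoring_force_height:
  fixes \<tau> :: real
  assumes "0 < c"
  defines "q \<equiv> sqrt (1 + \<tau>\<^sup>2)"
  shows "restoring_force c (c\<^sup>2 * b) (height c \<tau>) = sqrt c * (\<tau> - b * q ^ 4) / q"
proof -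
  have pos: "0 < 1 + \<tau>\<^sup>2" by (simp add: add_pos_nonneg)
  then have q: "0 < q" by (simp add: q_def)
  have "c - (height c \<tau>)\<^sup>2 = c / (1 + \<tau>\<^sup>2)"
    using assms pos by (simp add: height_square field_simps)
  then have r: "sqrt (c - (height c \<tau>)\<^sup>2) = sqrt c / q"
    by (simp add: real_sqrt_divide q_def)
  define s where "s = sqrt c"
  have s: "0 < s" "c = s\<^sup>2" using assms by (simp_all add: s_def)
  have "restoring_force c (c\<^sup>2 * b) (height c \<tau>) = s * \<tau> / q - c\<^sup>2 * b / (s / q) ^ 3"
    unfolding restoring_force_def r unfolding height_def q_def s_def ..
  also have "\<dots> = s * (\<tau> - b * q ^ 4) / q"
    unfolding s(2) using s(1) q by (simp add: field_simps eval_nat_numeral)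
  finally show ?thesis by (simp add: s_def)
qed

text \<open>The coefficient is the one that makes \<open>height c t\<close> an equilibrium. After
  the common factors sqrt c and 1 / q are split off, the equation is a polynomial identity once w^2
  is eliminated.\<close>

lemma DERIV_soliton_deriv:
  assumes "0 < c" and t: "0 < t" "3 * t\<^sup>2 < 1"
  shows "(soliton_deriv c t has_real_derivative
    restoring_force c (c\<^sup>2 * (t / (1 + t\<^sup>2)\<^sup>2)) (soliton c t x)) (at x)"
proof -
  define w \<tau> where "w = orbit (x, t)" and "\<tau> = orbit_slope t (orbit (x, t))"
  define q where "q = sqrt (1 + \<tau>\<^sup>2)"
  define m where "m = 1 + t\<^sup>2"
  have pos: "0 < m" "0 < 1 + \<tau>\<^sup>2" by (simp_all add: add_pos_nonneg m_def)
  then have q: "0 < q" "q\<^sup>2 = 1 + \<tau>\<^sup>2" by (simp_all add: q_def)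
  define w' \<tau>' where "w' = t * (\<tau> - t) * q\<^sup>2 / m" and "\<tau>' = - w * (\<tau> - t) * q\<^sup>2 / m"
  have dw: "((\<lambda>x. orbit (x, t)) has_real_derivative w') (at x)"
    using DERIV_orbit[OF t, of x] orbit_speed_eq[OF t(1), of w]
    by (simp add: w'_def q m_def w_def \<tau>_def)
  have d\<tau>: "((\<lambda>x. orbit_slope t (orbit (x, t))) has_real_derivative \<tau>') (at x)"
    using DERIV_orbit_slope[OF t, of x] by (simp add: \<tau>'_def q m_def w_def \<tau>_def)
  have dq: "((\<lambda>x. sqrt (1 + (orbit_slope t (orbit (x, t)))\<^sup>2)) has_real_derivative \<tau> / q * \<tau>') (at x)"
    unfolding q_def \<tau>_def by (rule DERIV_chain2[OF DERIV_sqrt_one_plus_square d\<tau>])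
  have "sqrt (1 + (orbit_slope t (orbit (x, t)))\<^sup>2) \<noteq> 0"
    using pos by (simp add: \<tau>_def)
  from DERIV_cmult_right[OF DERIV_divide[OF DERIV_mult[OF dw DERIV_diff[OF d\<tau> DERIV_const]] dq this],
      of t "- sqrt c / m"]
  have "(soliton_deriv c t has_real_derivative
      ((w' * (\<tau> - t) + (\<tau>' - 0) * w) * q - w * (\<tau> - t) * (\<tau> / q * \<tau>')) / (q * q) *
      (- sqrt c / m)) (at x)"
    unfolding soliton_deriv_def[abs_def] w_def \<tau>_def q_def m_def .
  also have "((w' * (\<tau> - t) + (\<tau>' - 0) * w) * q - w * (\<tau> - t) * (\<tau> / q * \<tau>')) / (q * q) *
      (- sqrt c / m) =
      sqrt c * (- (t * (\<tau> - t)\<^sup>2 * q\<^sup>2 - w\<^sup>2 * (\<tau> - t) * q\<^sup>2 + w\<^sup>2 * (\<tau> - t)\<^sup>2 * \<tau>) / m\<^sup>2) / q"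
    unfolding w'_def \<tau>'_def using q(1) pos(1)
    by (simp add: divide_simps) (simp add: algebra_simps power2_eq_square)
  also have "- (t * (\<tau> - t)\<^sup>2 * q\<^sup>2 - w\<^sup>2 * (\<tau> - t) * q\<^sup>2 + w\<^sup>2 * (\<tau> - t)\<^sup>2 * \<tau>) =
      \<tau> * m\<^sup>2 - t * q ^ 4"
  proof -
    have "2 * t * \<tau> = 1 - t\<^sup>2 - w\<^sup>2" using t by (simp add: \<tau>_def w_def orbit_slope_def)
    then have w2: "w\<^sup>2 = 1 - t\<^sup>2 - 2 * t * \<tau>" by simp
    have q4: "q ^ 4 = (1 + \<tau>\<^sup>2)\<^sup>2" using q(2) by (metis numeral_Bit0 power_add power2_eq_square)
    show ?thesis unfolding w2 q4 q(2) m_def by algebra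
  qed
  also have "(\<tau> * m\<^sup>2 - t * q ^ 4) / m\<^sup>2 = \<tau> - t / m\<^sup>2 * q ^ 4"
    using pos(1) by (simp add: field_simps)
  also have "sqrt c * (\<tau> - t / m\<^sup>2 * q ^ 4) / q =
      restoring_force c (c\<^sup>2 * (t / (1 + t\<^sup>2)\<^sup>2)) (soliton c t x)"
    unfolding restoring_force_height[OF \<open>0 < c\<close>] soliton_def by (simp add: q_def \<tau>_def m_def)
  finally show ?thesis .
qed

lemma smooth_on_soliton:
  "smooth_on (\<lambda>q. soliton c (snd q) (fst q)) {q. 0 < snd q \<and> 3 * (snd q)\<^sup>2 < 1}"
proof -
  have U: "open {q :: real \<times> real. 0 < snd q \<and> 3 * (snd q)\<^sup>2 < 1}"
    using smooth_on_orbit by (simp add: smooth_on_def)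
  have pos: "0 < 1 + ((1 - (snd q)\<^sup>2 - (orbit q)\<^sup>2) / (2 * snd q))\<^sup>2" for q
    by (simp add: add_pos_nonneg)
  then have nz: "sqrt (1 + ((1 - (snd q)\<^sup>2 - (orbit q)\<^sup>2) / (2 * snd q))\<^sup>2) \<noteq> 0" for q
    by (metis less_irrefl real_sqrt_eq_zero_cancel_iff)
  show ?thesis
    unfolding soliton_def height_def orbit_slope_def prod.collapse
    by (intro smooth_on_intros smooth_on_orbit U pos nz) auto
qed

lemma novikov_profile_soliton:
  assumes "0 < c" and t: "0 < t" "3 * t\<^sup>2 < 1"
  shows "novikov_profile c (c\<^sup>2 * (t / (1 + t\<^sup>2)\<^sup>2)) (soliton c t)"
proof -
  define a where "a = c\<^sup>2 * (t / (1 + t\<^sup>2)\<^sup>2)"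
  have "0 < 1 + t\<^sup>2" by (simp add: add_pos_nonneg)
  then have "0 < a" using assms by (simp add: a_def)
  have d1: "deriv (soliton c t) = soliton_deriv c t"
    using DERIV_soliton[OF t] DERIV_imp_deriv by blast
  have d2: "deriv (soliton_deriv c t) x = restoring_force c a (soliton c t x)" for x
    unfolding a_def by (rule DERIV_imp_deriv[OF DERIV_soliton_deriv[OF assms]])
  have sq: "(soliton c t x)\<^sup>2 < c" for x
    unfolding soliton_def by (rule height_square_less[OF \<open>0 < c\<close>])
  have ode: "soliton c t x - deriv (deriv (soliton c t)) x =
      a * (c - (soliton c t x)\<^sup>2) powr (- 3 / 2)" for x
    unfolding d1 d2 restoring_force_def using sq[of x] by (subst powr_minus_three_halves) simp_all
  have smooth: "smooth_on (soliton c t) UNIV"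
  proof -
    have "range (\<lambda>x. (x, t)) \<subseteq> {q. 0 < snd q \<and> 3 * (snd q)\<^sup>2 < 1}" using t by auto
    from smooth_on_compose[OF smooth_on_Pair[OF smooth_on_id smooth_on_const] smooth_on_soliton this]
    show ?thesis by simp
  qed
  \<comment> \<open>\<open>position\<close> vanishes at w = 0, so the crest sits at the origin, as
    the normalisation of profiles requires.\<close>
  have orbit_0: "orbit (0, t) = 0"
    using t by (intro orbit_eqI) (auto simp: mem_orbit_domain position_def)
  have "\<not> soliton c t constant_on UNIV"
  proof
    assume "soliton c t constant_on UNIV"
    then obtain y where "soliton c t = (\<lambda>_. y)" by (auto simp: constant_on_def)
    \<comment> \<open>One nonzero derivative refutes constancy. At 1 the orbit is off 0, since
      position 1 differs from \<open>position 0 t\<close>, and \<tau> differs from t because the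
      orbit speed is positive.\<close>
    then have "soliton_deriv c t 1 = 0"
      using DERIV_unique[OF DERIV_soliton[OF t, of c 1]] by simp
    moreover have "orbit (1, t) \<noteq> 0"
      using position_orbit[OF t, of 1] by (auto simp: position_def)
    moreover have "orbit_slope t (orbit (1, t)) \<noteq> t"
      using orbit_speed_pos[OF orbit_in_domain[OF t, of 1]] orbit_speed_eq[OF t(1), of "orbit (1, t)"]
      by auto
    moreover have "0 < 1 + (orbit_slope t (orbit (1, t)))\<^sup>2" by (simp add: add_pos_nonneg)
    ultimately show False
      using \<open>0 < c\<close> \<open>0 < 1 + t\<^sup>2\<close> by (simp add: soliton_deriv_def)
  qed
  moreover have "soliton c t x - deriv (deriv (soliton c t)) x > 0" for x
    unfolding ode using \<open>0 < a\<close> sq[of x] by (intro mult_pos_pos) auto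
  moreover have "deriv (soliton c t) 0 = 0"
    by (simp add: d1 soliton_deriv_def orbit_0)
  ultimately show ?thesis
    unfolding novikov_profile_def a_def[symmetric]
    using smooth soliton_end_state[OF t] ode sq by blast
qed

text \<open>The left side is largest at t^2 = 1/3. After squaring, the difference is a quartic in z
  = t^2 with a double root there and a cofactor positive for z \<ge> 0.\<close>

lemma coefficient_bound:
  fixes t :: real
  assumes "0 < t" "3 * t\<^sup>2 < 1"
  shows "t / (1 + t\<^sup>2)\<^sup>2 < 3 * sqrt 3 / 16"
proof -
  define z where "z = t\<^sup>2"
  have z: "0 \<le> z" "3 * z < 1" using assms by (simp_all add: z_def)
  have "27 * (1 + z) ^ 4 - 256 * z = (1 - 3 * z)\<^sup>2 * (3 * z\<^sup>2 + 14 * z + 27)"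
    by (simp add: eval_nat_numeral algebra_simps)
  also have "\<dots> > 0"
    using z by (intro mult_pos_pos add_nonneg_pos add_nonneg_nonneg) auto
  finally have "256 * z < 27 * (1 + z) ^ 4" by simp
  then have "(16 * t)\<^sup>2 < (3 * sqrt 3 * (1 + z)\<^sup>2)\<^sup>2"
    by (simp add: power_mult_distrib z_def[symmetric])
  then have "16 * t < 3 * sqrt 3 * (1 + z)\<^sup>2"
    by (rule power2_less_imp_less) simp
  moreover have "0 < (1 + z)\<^sup>2" using z by simp
  ultimately show ?thesis by (simp add: z_def[symmetric] field_simps)
qed

theorem corollary2p4:
  fixes c :: real
  assumes "c > 0"
  shows "(\<forall>\<phi>\<in>novikov_W c. \<exists>k. 0 < k \<and> k < sqrt c / 2 \<and> has_end_state \<phi> k) \<and>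
         (\<forall>k. 0 < k \<and> k < sqrt c / 2 \<longrightarrow> (\<exists>!\<phi>. \<phi> \<in> novikov_W c \<and> has_end_state \<phi> k)) \<and>
         smooth_on (\<lambda>(x, k). wave_of_end_state c k x) (UNIV \<times> {0<..<sqrt c / 2})"
proof (intro conjI ballI allI impI)
  fix \<phi> assume "\<phi> \<in> novikov_W c"
  then obtain a l where a: "0 < a" "a < 3 * sqrt 3 * c\<^sup>2 / 16" and \<phi>: "novikov_profile c a \<phi>"
    and l: "has_end_state \<phi> l"
    by (auto simp: novikov_W_def novikov_profile_def)
  then have "(\<phi> \<longlongrightarrow> l) at_top" by (simp add: has_end_state_def)
  then show "\<exists>k. 0 < k \<and> k < sqrt c / 2 \<and> has_end_state \<phi> k"
    using novikov_end_state_bounds[OF \<phi> a \<open>c > 0\<close>] l by blast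
next
  have slope: "k\<^sup>2 < c" "0 < slope c k" "3 * (slope c k)\<^sup>2 < 1" if "0 < k" "k < sqrt c / 2" for k
  proof -
    have "k < sqrt c" using that by linarith
    then show "k\<^sup>2 < c" using that by (auto simp: square_less_iff_interval)
    then show "0 < slope c k" "3 * (slope c k)\<^sup>2 < 1"
      using that slope_square_less_iff[OF \<open>c > 0\<close>] by (auto simp: slope_def)
  qed
  have soliton: "soliton c (slope c k) \<in> novikov_W c" "has_end_state (soliton c (slope c k)) k"
    if k: "0 < k" "k < sqrt c / 2" for k
  proof -
    let ?t = "slope c k"
    have "0 < 1 + ?t\<^sup>2" by (simp add: add_pos_nonneg)
    then have "0 < c\<^sup>2 * (?t / (1 + ?t\<^sup>2)\<^sup>2)" using \<open>c > 0\<close> slope(2)[OF k] by simp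
    moreover have "c\<^sup>2 * (?t / (1 + ?t\<^sup>2)\<^sup>2) < 3 * sqrt 3 * c\<^sup>2 / 16"
      using mult_strict_left_mono[OF coefficient_bound[OF slope(2,3)[OF k]], of "c\<^sup>2"] \<open>c > 0\<close>
      by (simp add: mult.commute)
    ultimately show "soliton c ?t \<in> novikov_W c"
      using novikov_profile_soliton[OF \<open>c > 0\<close> slope(2,3)[OF k]]
      unfolding novikov_W_def by blast
    show "has_end_state (soliton c ?t) k"
      using soliton_end_state[OF slope(2,3)[OF k], of c] height_slope[OF slope(1)[OF k]] by simp
  qed
  have unique: "\<phi> = \<psi>" if "\<phi> \<in> novikov_W c" "has_end_state \<phi> k"
      "\<psi> \<in> novikov_W c" "has_end_state \<psi> k"
    for \<phi> \<psi> k
    using that \<open>c > 0\<close> by (auto simp: novikov_W_def has_end_state_def intro: novikov_profile_eq)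
  show "\<exists>!\<phi>. \<phi> \<in> novikov_W c \<and> has_end_state \<phi> k" if "0 < k \<and> k < sqrt c / 2" for k
    using soliton[of k] that unique by blast
  \<comment> \<open>Uniqueness identifies the definite description with the explicit wave, so
    smoothness in (x, k) follows by substituting t = \<open>slope c k\<close>, itself smooth in
    \<open>k\<close>.\<close>
  have wave: "soliton c (slope c k) = wave_of_end_state c k" if "0 < k" "k < sqrt c / 2" for k
    unfolding wave_of_end_state_def
    by (rule the_equality[symmetric]) (use soliton[OF that] unique in blast)+
  let ?V = "UNIV \<times> {0<..<sqrt c / 2} :: (real \<times> real) set"
  have V: "open ?V" by (intro open_Times) auto
  have sub: "(\<lambda>p. (fst p, slope c (snd p))) ` ?V \<subseteq> {q. 0 < snd q \<and> 3 * (snd q)\<^sup>2 < 1}"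
    using slope by auto
  have "smooth_on (\<lambda>p. (fst p, slope c (snd p))) ?V"
    unfolding slope_def by (intro smooth_on_intros V) (use slope(1) in force)+
  from smooth_on_compose[OF this smooth_on_soliton sub]
  have "smooth_on (\<lambda>p. soliton c (slope c (snd p)) (fst p)) ?V"
    by simp
  then show "smooth_on (\<lambda>(x, k). wave_of_end_state c k x) ?V"
    by (rule smooth_on_cong) (auto simp: wave)
qed

end
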